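(* Let $G$ be a finite simple connected undirected graph on $V=\{1,\dots,n\}$ with $m$ edges, every vertex of degree at least $2$, and $G$ not a cycle. Then \[ M^{(nb)}_v=J_{n,n}-Z^{(nb)}_vR+W_vM^{(nb)}_v-E, \] where $E=D^{-1}TZ^{(nb)}_eD_e^{-1}F$ and $F=-(\tau-P_{nb})Y$. In particular, writing $m_{ij}=(M^{(nb)}_v)_{ij}$ and $z_{ij}=(Z^{(nb)}_v)_{ij}$, for all $i,j\in V$, \[ m_{ij}=\frac{z_{jj}-z_{ij}}{\pi_j}+E_{jj}-E_{ij}. \]
   Context: $d_i=\deg(i)$, $D=\mathrm{diag}(d_i)$, $J_{n,n}$ the all-ones matrix. Directed edges: the $2m$ ordered pairs $(i,j)$ with $\{i,j\}$ an edge. $P_{nb}((i,j),(k,\ell))=\frac1{d_j-1}$ if $j=k,\ell\ne i$, else $0$. $T$ ($n\times2m$): $T(x,(i,j))=1$ iff $i=x$. $D_e=\mathrm{diag}$ with $D_e((i,j),(i,j))=d_j$. $\tau((i,j),(k,\ell))=1$ iff $(k,\ell)=(j,i)$. $\pi_i=d_i/(2m)$, $\pi_e=\frac1{2m}\mathbb 1$, $W_v=\mathbb 1\pi^\top$, $W_e=\mathbb 1\pi_e^\top$, $Z^{(nb)}_e=(I-P_{nb}+W_e)^{-1}$, $Z^{(nb)}_v=D^{-1}TZ^{(nb)}_eT^\top$. NBRW on vertices: $\tilde X_1$ uniform neighbor of $\tilde X_0$; for $k\ge1$, $\tilde X_{k+1}$ uniform among neighbors of $\tilde X_k$ other than $\tilde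 X_{k-1}$; $\tilde T_v=\min\{k\ge0:\tilde X_k=v\}$, $\tilde T_v^+=\min\{k\ge1:\tilde X_k=v\}$. $M^{(nb)}_v$: $n\times n$, entries $\mathbb E[\tilde T_j\mid\tilde X_0=i]$. $M^{(nb)}_{ev}$: $2m\times n$, entries $\mathbb E[\tilde T_v\mid\tilde X_0=i,\tilde X_1=j]$. $R=\mathrm{diag}(\mathbb E[\tilde T_i^+\mid\tilde X_0=i])$. $Y$: $2m\times n$ with $Y_{(i,j),k}=0$ if $k\ne i$ and $Y_{(i,j),i}=1+\sum_{\ell}P_{nb}((i,j),(j,\ell))(M^{(nb)}_{ev})_{(j,\ell),i}$. *)

theory Defs
  imports "HOL-Probability.Probability"
begin

section \<open>Graphs\<close>

text \<open>
  A simple undirected graph on the finite vertex type \<open>'v\<close> (so that \<open>n = CARD('v)\<close>) is given by its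
  adjacency relation.
\<close>

definition simple_graph :: "('v \<Rightarrow> 'v \<Rightarrow> bool) \<Rightarrow> bool" where
  "simple_graph adj \<longleftrightarrow> symp adj \<and> irreflp adj"

definition connected_graph :: "('v \<Rightarrow> 'v \<Rightarrow> bool) \<Rightarrow> bool" where
  "connected_graph adj \<longleftrightarrow> (\<forall>u v. adj\<^sup>*\<^sup>* u v)"

definition cycle_graph :: "('v::finite \<Rightarrow> 'v \<Rightarrow> bool) \<Rightarrow> bool" where
  "cycle_graph adj \<longleftrightarrow> 3 \<le> CARD('v) \<and>
     (\<exists>c :: nat \<Rightarrow> 'v. bij_betw c {..<CARD('v)} UNIV \<and>
        (\<forall>a<CARD('v). \<forall>b<CARD('v).
           adj (c a) (c b) \<longleftrightarrow> b = (a + 1) mod CARD('v) \<or> a = (b + 1) mod CARD('v)))"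

definition nbrs :: "('v \<Rightarrow> 'v \<Rightarrow> bool) \<Rightarrow> 'v \<Rightarrow> 'v set" where
  "nbrs adj v = {w. adj v w}"

definition vdeg :: "('v \<Rightarrow> 'v \<Rightarrow> bool) \<Rightarrow> 'v \<Rightarrow> nat" where
  "vdeg adj v = card (nbrs adj v)"

definition num_edges :: "('v \<Rightarrow> 'v \<Rightarrow> bool) \<Rightarrow> nat" where
  "num_edges adj = card {{u, v} |u v. adj u v}"

definition dir_edges :: "('v \<Rightarrow> 'v \<Rightarrow> bool) \<Rightarrow> ('v \<times> 'v) set" where
  "dir_edges adj = {(i, j). adj i j}"

text \<open>
  To have \<open>2m\<close>-dimensional matrices in the type \<open>real^'e^'e\<close>, the directed edges are indexed
  by a finite type \<open>'e\<close> through a bijection \<open>de\<close> onto \<open>dir_edges adj\<close>: the index \<open>e\<close> stands for the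
  ordered pair \<open>de e\<close>.  An \<open>r\<close> by \<open>c\<close> matrix has type \<open>real^'c^'r\<close>.
\<close>

definition indexes_dir_edges :: "('v \<Rightarrow> 'v \<Rightarrow> bool) \<Rightarrow> ('e::finite \<Rightarrow> 'v \<times> 'v) \<Rightarrow> bool" where
  "indexes_dir_edges adj de \<longleftrightarrow> bij_betw de UNIV (dir_edges adj)"


section \<open>The non-backtracking random walk on vertices\<close>

text \<open>The conditional law of \<open>X k\<close> given the trajectory \<open>\<omega>\<close> up to time \<open>k - 1\<close>, for the walk from \<open>i\<close>.\<close>

fun nbrw_step :: "('v::finite \<Rightarrow> 'v \<Rightarrow> bool) \<Rightarrow> 'v \<Rightarrow> nat \<Rightarrow> (nat \<Rightarrow> 'v) \<Rightarrow> 'v measure" where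
  "nbrw_step adj i 0 \<omega> = measure_pmf (return_pmf i)"
| "nbrw_step adj i (Suc 0) \<omega> = measure_pmf (pmf_of_set (nbrs adj (\<omega> 0)))"
| "nbrw_step adj i (Suc (Suc k)) \<omega> =
     measure_pmf (pmf_of_set (nbrs adj (\<omega> (Suc k)) - {\<omega> k}))"

lemma measurable_nbrw_step:
  "nbrw_step adj i k \<in>
     measurable (PiM {0..<k} (\<lambda>_. count_space UNIV)) (subprob_algebra (count_space UNIV))"
proof -
  consider "k = 0" | "k = Suc 0" | l where "k = Suc (Suc l)"
    by (metis not0_implies_Suc)
  then show ?thesis
  proof cases
    case 1
    have "nbrw_step adj i 0 = (\<lambda>_. measure_pmf (return_pmf i))"
      by (rule ext) simp
    then show ?thesis
      unfolding 1 by (simp add: measure_pmf_in_subprob_algebra)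
  next
    case 2
    have "(\<lambda>\<omega>. \<omega> 0) \<in> measurable (PiM {0..<Suc 0} (\<lambda>_. count_space UNIV)) (count_space UNIV)"
      by (rule measurable_component_singleton) simp
    moreover have "(\<lambda>x. measure_pmf (pmf_of_set (nbrs adj x)))
        \<in> measurable (count_space UNIV) (subprob_algebra (count_space UNIV))"
      by (simp add: measure_pmf_in_subprob_algebra)
    ultimately have "(\<lambda>\<omega>. measure_pmf (pmf_of_set (nbrs adj (\<omega> 0))))
        \<in> measurable (PiM {0..<Suc 0} (\<lambda>_. count_space UNIV)) (subprob_algebra (count_space UNIV))"
      by (rule measurable_compose)
    moreover have "nbrw_step adj i (Suc 0) = (\<lambda>\<omega>. measure_pmf (pmf_of_set (nbrs adj (\<omega> 0))))"
      by (rule ext) simp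
    ultimately show ?thesis
      unfolding 2 by simp
  next
    case 3
    let ?M = "PiM {0..<k} (\<lambda>_. count_space UNIV) :: (nat \<Rightarrow> 'a) measure"
    have m1: "(\<lambda>\<omega>. \<omega> (Suc l)) \<in> measurable ?M (count_space UNIV)"
      using 3 by (intro measurable_component_singleton) simp
    have m2: "(\<lambda>\<omega>. \<omega> l) \<in> measurable ?M (count_space UNIV)"
      using 3 by (intro measurable_component_singleton) simp
    have "(\<lambda>\<omega>. measure_pmf (pmf_of_set (nbrs adj (\<omega> (Suc l)) - {y})))
        \<in> measurable ?M (subprob_algebra (count_space UNIV))" for y
      by (rule measurable_compose[OF m1]) (simp add: measure_pmf_in_subprob_algebra)
    from measurable_compose_countable[OF this m2]
    have "(\<lambda>\<omega>. measure_pmf (pmf_of_set (nbrs adj (\<omega> (Suc l)) - {\<omega> l})))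
        \<in> measurable ?M (subprob_algebra (count_space UNIV))" .
    moreover have "nbrw_step adj i k =
        (\<lambda>\<omega>. measure_pmf (pmf_of_set (nbrs adj (\<omega> (Suc l)) - {\<omega> l})))"
      unfolding 3 by (rule ext) simp
    ultimately show ?thesis
      by simp
  qed
qed

lemma prob_space_nbrw_step: "prob_space (nbrw_step adj i k \<omega>)"
  by (induction adj i k \<omega> rule: nbrw_step.induct) (simp_all add: measure_pmf.prob_space_axioms)

interpretation nbrw: Ionescu_Tulcea "nbrw_step adj i" "\<lambda>_. count_space UNIV"
  for adj :: "'v::finite \<Rightarrow> 'v \<Rightarrow> bool" and i
  by (rule Ionescu_Tulcea.intro) (rule measurable_nbrw_step prob_space_nbrw_step)+

text \<open>The law of the walk started at \<open>X 0 = i\<close>, on the space of trajectories (Ionescu-Tulcea).\<close>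

definition nbrw_law :: "('v::finite \<Rightarrow> 'v \<Rightarrow> bool) \<Rightarrow> 'v \<Rightarrow> (nat \<Rightarrow> 'v) measure" where
  "nbrw_law adj i = nbrw.PF.lim adj i"

text \<open>The law conditioned on \<open>X 1 = j\<close>; the conditioning event has probability \<open>1 / d\<^sub>i\<close> if \<open>adj i j\<close>.\<close>

definition nbrw_law2 :: "('v::finite \<Rightarrow> 'v \<Rightarrow> bool) \<Rightarrow> 'v \<Rightarrow> 'v \<Rightarrow> (nat \<Rightarrow> 'v) measure" where
  "nbrw_law2 adj i j = uniform_measure (nbrw_law adj i) {\<omega>. \<omega> 0 = i \<and> \<omega> 1 = j}"

text \<open>Times take the value \<open>\<infinity>\<close> (the infimum of the empty set) on trajectories missing \<open>v\<close>.\<close>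

definition hit_time :: "'v \<Rightarrow> (nat \<Rightarrow> 'v) \<Rightarrow> enat" where
  "hit_time v \<omega> = Inf {enat k |k. \<omega> k = v}"

definition return_time :: "'v \<Rightarrow> (nat \<Rightarrow> 'v) \<Rightarrow> enat" where
  "return_time v \<omega> = Inf {enat k |k. 1 \<le> k \<and> \<omega> k = v}"

definition mean_time :: "(nat \<Rightarrow> 'v) measure \<Rightarrow> ((nat \<Rightarrow> 'v) \<Rightarrow> enat) \<Rightarrow> real" where
  "mean_time M S = enn2real (\<integral>\<^sup>+ \<omega>. ennreal_of_enat (S \<omega>) \<partial>M)"


section \<open>Matrices\<close>

definition diag_mat :: "('a \<Rightarrow> real) \<Rightarrow> real^'a^'a" where
  "diag_mat f = (\<chi> i j. if i = j then f i else 0)"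

definition ones_mat :: "real^'b^'a" where
  "ones_mat = (\<chi> i j. 1)"

definition deg_mat :: "('v::finite \<Rightarrow> 'v \<Rightarrow> bool) \<Rightarrow> real^'v^'v" where
  "deg_mat adj = diag_mat (\<lambda>i. real (vdeg adj i))"

definition P_nb :: "('v \<Rightarrow> 'v \<Rightarrow> bool) \<Rightarrow> ('e::finite \<Rightarrow> 'v \<times> 'v) \<Rightarrow> real^'e^'e" where
  "P_nb adj de = (\<chi> e f. case (de e, de f) of ((i, j), (k, l)) \<Rightarrow>
     if j = k \<and> l \<noteq> i then 1 / (real (vdeg adj j) - 1) else 0)"

definition T_mat :: "('e::finite \<Rightarrow> 'v::finite \<times> 'v) \<Rightarrow> real^'e^'v" where
  "T_mat de = (\<chi> x e. if fst (de e) = x then 1 else 0)"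

definition De_mat :: "('v \<Rightarrow> 'v \<Rightarrow> bool) \<Rightarrow> ('e::finite \<Rightarrow> 'v \<times> 'v) \<Rightarrow> real^'e^'e" where
  "De_mat adj de = diag_mat (\<lambda>e. real (vdeg adj (snd (de e))))"

definition tau_mat :: "('e::finite \<Rightarrow> 'v \<times> 'v) \<Rightarrow> real^'e^'e" where
  "tau_mat de = (\<chi> e f. if de f = (snd (de e), fst (de e)) then 1 else 0)"

definition pi_v :: "('v::finite \<Rightarrow> 'v \<Rightarrow> bool) \<Rightarrow> real^'v" where
  "pi_v adj = (\<chi> i. real (vdeg adj i) / (2 * real (num_edges adj)))"

definition pi_e :: "('v \<Rightarrow> 'v \<Rightarrow> bool) \<Rightarrow> real^'e" where
  "pi_e adj = (\<chi> e. 1 / (2 * real (num_edges adj)))"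

definition W_v :: "('v::finite \<Rightarrow> 'v \<Rightarrow> bool) \<Rightarrow> real^'v^'v" where
  "W_v adj = (\<chi> i j. pi_v adj $ j)"

definition W_e :: "('v \<Rightarrow> 'v \<Rightarrow> bool) \<Rightarrow> real^'e^'e" where
  "W_e adj = (\<chi> e f. pi_e adj $ f)"

definition Z_e :: "('v \<Rightarrow> 'v \<Rightarrow> bool) \<Rightarrow> ('e::finite \<Rightarrow> 'v \<times> 'v) \<Rightarrow> real^'e^'e" where
  "Z_e adj de = matrix_inv (mat 1 - P_nb adj de + W_e adj)"

definition Z_v :: "('v::finite \<Rightarrow> 'v \<Rightarrow> bool) \<Rightarrow> ('e::finite \<Rightarrow> 'v \<times> 'v) \<Rightarrow> real^'v^'v" where
  "Z_v adj de = matrix_inv (deg_mat adj) ** T_mat de ** Z_e adj de ** transpose (T_mat de)"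

definition M_v :: "('v::finite \<Rightarrow> 'v \<Rightarrow> bool) \<Rightarrow> real^'v^'v" where
  "M_v adj = (\<chi> i j. mean_time (nbrw_law adj i) (hit_time j))"

definition M_ev :: "('v::finite \<Rightarrow> 'v \<Rightarrow> bool) \<Rightarrow> ('e::finite \<Rightarrow> 'v \<times> 'v) \<Rightarrow> real^'v^'e" where
  "M_ev adj de = (\<chi> e v. case de e of (i, j) \<Rightarrow> mean_time (nbrw_law2 adj i j) (hit_time v))"

definition R_mat :: "('v::finite \<Rightarrow> 'v \<Rightarrow> bool) \<Rightarrow> real^'v^'v" where
  "R_mat adj = diag_mat (\<lambda>i. mean_time (nbrw_law adj i) (return_time i))"

text \<open>
  The sum over \<open>f\<close> runs over the directed edges \<open>(j, l)\<close> out of the head \<open>j\<close> of \<open>e = (i, j)\<close>.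
\<close>

definition Y_mat :: "('v::finite \<Rightarrow> 'v \<Rightarrow> bool) \<Rightarrow> ('e::finite \<Rightarrow> 'v \<times> 'v) \<Rightarrow> real^'v^'e" where
  "Y_mat adj de = (\<chi> e k.
     if k \<noteq> fst (de e) then 0
     else 1 + (\<Sum>f | fst (de f) = snd (de e). P_nb adj de $ e $ f * M_ev adj de $ f $ k))"

definition F_mat :: "('v::finite \<Rightarrow> 'v \<Rightarrow> bool) \<Rightarrow> ('e::finite \<Rightarrow> 'v \<times> 'v) \<Rightarrow> real^'v^'e" where
  "F_mat adj de = - ((tau_mat de - P_nb adj de) ** Y_mat adj de)"

definition E_mat :: "('v::finite \<Rightarrow> 'v \<Rightarrow> bool) \<Rightarrow> ('e::finite \<Rightarrow> 'v \<times> 'v) \<Rightarrow> real^'v^'v" where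
  "E_mat adj de = matrix_inv (deg_mat adj) ** T_mat de ** Z_e adj de
     ** matrix_inv (De_mat adj de) ** F_mat adj de"

end

theory Submission
  imports Defs
begin

text \<open>
  Let \<open>y(e, v)\<close> be the mean first time \<open>k \<ge> 1\<close> at which the walk with initial directed edge \<open>e\<close> is
  at \<open>v\<close>.  Conditioning on one step gives \<open>(I - P) M = J - Y\<close> for the edge-to-vertex hitting
  times \<open>M\<close>, and \<open>Z (I - P) = I - W\<close> turns this into \<open>M = J - Z Y + W M\<close>; averaging over the
  out-edges of each vertex (\<open>D\<^sup>-\<^sup>1 T\<close>) gives the vertex version with \<open>D\<^sup>-\<^sup>1 T Z Y\<close> in place of
  \<open>Z\<^sub>v R + E\<close>.  The two agree because \<open>U = Y - T\<^sup>t R\<close> (\<open>Y_dev\<close>) sums to zero over the out-edges of every vertex: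
  this makes \<open>D\<^sub>e\<^sup>-\<^sup>1 F = P U\<close>, and \<open>D\<^sup>-\<^sup>1 T Z (I - P) U = D\<^sup>-\<^sup>1 T (I - W) U = 0\<close>.  Since \<open>P\<close> is doubly
  stochastic, the column sums of \<open>(I - P) M = J - Y\<close> give \<open>R\<^sub>j\<^sub>j = 1 / \<pi>\<^sub>j\<close>, whence the entrywise formula.

  Both the invertibility of \<open>I - P + W\<close> and the finiteness of the hitting times come from a maximum
  principle, which needs \<open>P\<close> to be irreducible.  Double stochasticity makes reachability symmetric, so
  it suffices to propagate reachability from a vertex of degree at least three, which exists because a
  connected 2-regular graph is a cycle.
\<close>

section \<open>The law of the walk\<close>

text \<open>The projective limit has the kernel compositions \<open>C 0 n\<close> as marginals on
  initial segments, so integrals over the first \<open>n\<close> coordinates reduce to finitely many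
  steps.\<close>

lemma (in Ionescu_Tulcea) nn_integral_lim_restrict:
  assumes f[measurable]: "f \<in> borel_measurable (PiM {0..<n} M)"
  shows "(\<integral>\<^sup>+\<omega>. f (restrict \<omega> {0..<n}) \<partial>PF.lim) = (\<integral>\<^sup>+\<omega>. f \<omega> \<partial>C 0 n (\<lambda>_. undefined))"
proof -
  \<comment> \<open>\<open>CI\<close> is built from the least initial segment covering the index
    set; for \<open>{0..<n}\<close> this is \<open>n\<close> itself, and the restriction inside
    \<open>CI\<close> becomes trivial.\<close>
  have up: "up_to {0..<n} = n"
    by (metis antisym atLeastLessThan_iff finite_atLeastLessThan le0 le_refl not_less up_to_iff)
  have "(\<integral>\<^sup>+\<omega>. f (restrict \<omega> {0..<n}) \<partial>PF.lim) =
      (\<integral>\<^sup>+\<omega>. f \<omega> \<partial>distr PF.lim (PiM {0..<n} M) (\<lambda>\<omega>. restrict \<omega> {0..<n}))"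
    by (subst nn_integral_distr) (auto intro!: measurable_restrict simp: measurable_cong_sets[OF PF.sets_lim])
  also have "\<dots> = (\<integral>\<^sup>+\<omega>. f \<omega> \<partial>C 0 n (\<lambda>_. undefined))"
    unfolding distr_lim[OF finite_atLeastLessThan] CI_def up
    using distr_C[of n n "\<lambda>_. undefined" 0] by simp
  finally show ?thesis .
qed

text \<open>\<open>C 0 (Suc n)\<close> is \<open>C 0 n\<close> bound to \<open>eP n\<close>. Pulling
  the inner marginal back to the limit keeps one fixed measure for all \<open>n\<close>.\<close>

lemma (in Ionescu_Tulcea) nn_integral_lim_Suc:
  assumes f[measurable]: "f \<in> borel_measurable (PiM {0..<Suc n} M)"
  shows "(\<integral>\<^sup>+\<omega>. f (restrict \<omega> {0..<Suc n}) \<partial>PF.lim) =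
    (\<integral>\<^sup>+\<omega>. \<integral>\<^sup>+x. f (fun_upd (restrict \<omega> {0..<n}) n x) \<partial>P n (restrict \<omega> {0..<n}) \<partial>PF.lim)"
proof -
  let ?u = "\<lambda>_::nat. undefined :: 'a"
  have s: "?u \<in> space (PiM {0..<0} M)"
    by simp
  have "(\<integral>\<^sup>+\<omega>. f (restrict \<omega> {0..<Suc n}) \<partial>PF.lim) = (\<integral>\<^sup>+\<omega>. f \<omega> \<partial>(C 0 n ?u \<bind> eP n))"
    by (simp add: nn_integral_lim_restrict[OF f])
  also have "\<dots> = (\<integral>\<^sup>+\<omega>. (\<integral>\<^sup>+x. f x \<partial>eP n \<omega>) \<partial>C 0 n ?u)"
    using measurable_eP[of n] sets_C[OF s, of n]
    by (intro nn_integral_bind[where B="PiM {0..<Suc n} M"]) (simp_all cong: measurable_cong_sets)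
  also have "\<dots> = (\<integral>\<^sup>+\<omega>. (\<integral>\<^sup>+x. f x \<partial>eP n (restrict \<omega> {0..<n})) \<partial>PF.lim)"
    by (subst nn_integral_lim_restrict) auto
  also have "\<dots> = (\<integral>\<^sup>+\<omega>. \<integral>\<^sup>+x. f (fun_upd (restrict \<omega> {0..<n}) n x) \<partial>P n (restrict \<omega> {0..<n}) \<partial>PF.lim)"
    by (intro nn_integral_cong nn_integral_eP f) (auto simp: space_PiM)
  finally show ?thesis .
qed

lemma nbrw_step_cong:
  "(\<And>k. k < n \<Longrightarrow> \<omega> k = \<omega>' k) \<Longrightarrow> nbrw_step adj i n \<omega> = nbrw_step adj i n \<omega>'"
  by (induction adj i n \<omega> rule: nbrw_step.induct) auto

lemma space_nbrw_law [simp]: "space (nbrw_law adj i) = UNIV"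
  by (simp add: nbrw_law_def space_PiM)

lemma sets_nbrw_law [measurable_cong]:
  "sets (nbrw_law adj i) = sets (PiM UNIV (\<lambda>_. count_space UNIV))"
  by (simp add: nbrw_law_def)

lemma emeasure_nbrw_law_UNIV: "emeasure (nbrw_law adj i) UNIV = 1"
proof -
  have "emeasure (nbrw_law adj i) UNIV = (\<integral>\<^sup>+\<omega>. 1 \<partial>nbrw_law adj i)"
    by simp
  also have "\<dots> = (\<integral>\<^sup>+\<omega>. 1 \<partial>nbrw.C adj i 0 0 (\<lambda>_. undefined))"
    unfolding nbrw_law_def by (rule nbrw.nn_integral_lim_restrict) simp
  also have "\<dots> = 1"
    by (subst nbrw.C.simps(1), subst nn_integral_return) (auto simp: space_PiM)
  finally show ?thesis .
qed

lemma sets_PiM_UNIV_coordinates: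
  "{\<omega>. \<forall>k. \<omega> k \<in> A k} \<in> sets (PiM (UNIV :: nat set) (\<lambda>_. count_space UNIV))"
proof -
  have "{\<omega>. \<forall>k. \<omega> k \<in> A k} = PiE UNIV A"
    by auto
  then show ?thesis
    by (simp only:) (rule sets_PiM_I_countable, simp_all)
qed

lemma sets_avoid:
  "{\<omega>. \<forall>k\<in>S. \<omega> k \<noteq> v} \<in> sets (PiM (UNIV :: nat set) (\<lambda>_. count_space UNIV))"
proof -
  have "{\<omega>. \<forall>k\<in>S. \<omega> k \<noteq> v} = {\<omega>. \<forall>k. \<omega> k \<in> (if k \<in> S then - {v} else UNIV)}"
    by auto
  then show ?thesis
    by (simp only: sets_PiM_UNIV_coordinates)
qed

text \<open>A function of the coordinates up to \<open>n\<close> does not see the truncation of the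
  trajectory, so the last coordinate can be integrated out on full trajectories.\<close>

lemma nn_integral_nbrw_law_step:
  fixes f :: "(nat \<Rightarrow> 'v::finite) \<Rightarrow> ennreal"
  assumes f: "\<And>\<omega> \<omega>'. (\<And>k. k \<le> n \<Longrightarrow> \<omega> k = \<omega>' k) \<Longrightarrow> f \<omega> = f \<omega>'"
  shows "(\<integral>\<^sup>+\<omega>. f \<omega> \<partial>nbrw_law adj i) =
    (\<integral>\<^sup>+\<omega>. \<integral>\<^sup>+x. f (fun_upd \<omega> n x) \<partial>nbrw_step adj i n \<omega> \<partial>nbrw_law adj i)"
proof -
  \<comment> \<open>A finite product of finite discrete spaces carries the full power set, which
    makes every function measurable.\<close>
  have "f \<in> borel_measurable (PiM {0..<Suc n} (\<lambda>_. count_space UNIV))"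
    by (subst count_space_PiM_finite) auto
  note nbrw.nn_integral_lim_Suc[OF this, of adj i, folded nbrw_law_def]
  moreover have "f (restrict \<omega> {0..<Suc n}) = f \<omega>" for \<omega>
    by (rule f) auto
  moreover have "f (fun_upd (restrict \<omega> {0..<n}) n x) = f (fun_upd \<omega> n x)" for \<omega> x
    by (rule f) auto
  moreover have "nbrw_step adj i n (restrict \<omega> {0..<n}) = nbrw_step adj i n \<omega>" for \<omega>
    by (rule nbrw_step_cong) auto
  ultimately show ?thesis by simp
qed

section \<open>Survival probabilities along directed edges\<close>

definition avoid_step :: "('v::finite \<Rightarrow> 'v \<Rightarrow> bool) \<Rightarrow> 'v \<Rightarrow> ('v \<Rightarrow> 'v \<Rightarrow> ennreal) \<Rightarrow> 'v \<Rightarrow> 'v \<Rightarrow> ennreal"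
  where "avoid_step adj v G a b =
    (if b = v then 0 else \<integral>\<^sup>+c. G b c \<partial>measure_pmf (pmf_of_set (nbrs adj b - {a})))"

text \<open>The probability of missing \<open>v\<close> at all times from 1 to \<open>n\<close>,
  given \<open>X 0 = a\<close> and \<open>X 1 = b\<close>. Time 0 is not tested, in accordance with
  \<open>return_time\<close>. The state is a pair because the walk is Markov only on directed
  edges.\<close>

definition survival :: "('v::finite \<Rightarrow> 'v \<Rightarrow> bool) \<Rightarrow> 'v \<Rightarrow> nat \<Rightarrow> 'v \<Rightarrow> 'v \<Rightarrow> ennreal"
  where "survival adj v n = (avoid_step adj v ^^ n) (\<lambda>_ _. 1)"

text \<open>
  The law is built by appending steps at the end; integrating out the last step replaces \<open>G\<close> by
  \<open>avoid_step adj v G\<close>, so that the iterates satisfy a recursion in the first step.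
\<close>

lemma nn_integral_nbrw_law_avoid:
  fixes H G :: "'v::finite \<Rightarrow> 'v \<Rightarrow> ennreal"
  shows "(\<integral>\<^sup>+\<omega>. H (\<omega> 0) (\<omega> 1) * indicator {\<omega>. \<forall>k\<in>{1..n}. \<omega> k \<noteq> v} \<omega> * G (\<omega> n) (\<omega> (Suc n))
      \<partial>nbrw_law adj i) =
    (\<integral>\<^sup>+c. H i c * (avoid_step adj v ^^ n) G i c \<partial>measure_pmf (pmf_of_set (nbrs adj i)))"
proof (induction n arbitrary: G)
  \<comment> \<open>Coordinate 1 is integrated out first, then coordinate 0, whose kernel is the
    point mass at \<open>i\<close>.\<close>
  case 0
  have "(\<integral>\<^sup>+\<omega>. H (\<omega> 0) (\<omega> 1) * G (\<omega> 0) (\<omega> 1) \<partial>nbrw_law adj i) =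
    (\<integral>\<^sup>+\<omega>. \<integral>\<^sup>+x. H (\<omega> 0) x * G (\<omega> 0) x \<partial>measure_pmf (pmf_of_set (nbrs adj (\<omega> 0))) \<partial>nbrw_law adj i)"
    by (subst nn_integral_nbrw_law_step[where n=1]) auto
  also have "\<dots> = (\<integral>\<^sup>+\<omega>. (\<integral>\<^sup>+x. H i x * G i x \<partial>measure_pmf (pmf_of_set (nbrs adj i)))
       \<partial>nbrw_law adj i)"
    by (subst nn_integral_nbrw_law_step[where n=0]) (auto)
  also have "\<dots> = (\<integral>\<^sup>+x. H i x * G i x \<partial>measure_pmf (pmf_of_set (nbrs adj i)))"
    by (simp add: emeasure_nbrw_law_UNIV)
  finally show ?case by simp
next
  \<comment> \<open>The indicator does not involve the last coordinate, so only \<open>G\<close> is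
    averaged; the constraint at time \<open>Suc n\<close> then becomes the killing at
    \<open>v\<close> in \<open>avoid_step\<close>.\<close>
  case (Suc n)
  let ?I = "\<lambda>n. indicator {\<omega>. \<forall>k\<in>{1..n}. \<omega> k \<noteq> v} :: _ \<Rightarrow> ennreal"
  have "(\<integral>\<^sup>+\<omega>. H (\<omega> 0) (\<omega> 1) * ?I (Suc n) \<omega> * G (\<omega> (Suc n)) (\<omega> (Suc (Suc n))) \<partial>nbrw_law adj i) =
    (\<integral>\<^sup>+\<omega>. \<integral>\<^sup>+x. H (\<omega> 0) (\<omega> 1) * ?I (Suc n) \<omega> * G (\<omega> (Suc n)) x
       \<partial>measure_pmf (pmf_of_set (nbrs adj (\<omega> (Suc n)) - {\<omega> n})) \<partial>nbrw_law adj i)"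
    by (subst nn_integral_nbrw_law_step[where n="Suc (Suc n)"]) (auto simp: indicator_def)
  also have "\<dots> = (\<integral>\<^sup>+\<omega>. H (\<omega> 0) (\<omega> 1) * ?I n \<omega> * avoid_step adj v G (\<omega> n) (\<omega> (Suc n)) \<partial>nbrw_law adj i)"
    by (intro nn_integral_cong)
       (auto simp: nn_integral_cmult avoid_step_def indicator_def atLeastAtMostSuc_conv)
  finally show ?case
    by (simp only: Suc.IH funpow_Suc_right o_apply)
qed


section \<open>Mean hitting and return times as sums of tails\<close>

lemma enat_less_hit_time_iff: "enat n < hit_time v \<omega> \<longleftrightarrow> (\<forall>k\<le>n. \<omega> k \<noteq> v)"
proof -
  have "enat n < hit_time v \<omega> \<longleftrightarrow> eSuc (enat n) \<le> hit_time v \<omega>"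
    by (simp add: ileI1 iless_Suc_eq eSuc_enat Suc_ile_eq)
  also have "\<dots> \<longleftrightarrow> (\<forall>k. \<omega> k = v \<longrightarrow> Suc n \<le> k)"
    unfolding hit_time_def eSuc_enat by (auto simp: le_Inf_iff)
  finally show ?thesis
    by (auto simp: not_less_eq_eq)
qed

lemma enat_less_return_time_iff: "enat n < return_time v \<omega> \<longleftrightarrow> (\<forall>k\<in>{1..n}. \<omega> k \<noteq> v)"
proof -
  have "enat n < return_time v \<omega> \<longleftrightarrow> eSuc (enat n) \<le> return_time v \<omega>"
    by (simp add: ileI1 iless_Suc_eq eSuc_enat Suc_ile_eq)
  also have "\<dots> \<longleftrightarrow> (\<forall>k\<ge>1. \<omega> k = v \<longrightarrow> Suc n \<le> k)"
    unfolding return_time_def eSuc_enat by (auto simp: le_Inf_iff)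
  also have "\<dots> \<longleftrightarrow> (\<forall>k\<in>{1..n}. \<omega> k \<noteq> v)"
    by (metis One_nat_def atLeastAtMost_iff not_less_eq_eq)
  finally show ?thesis .
qed

text \<open>Since \<open>enat\<close> is countable, preimages of points suffice: finite points come
  from differences of tail events, infinity from their countable intersection.\<close>

lemma measurable_enatI:
  fixes f :: "'a \<Rightarrow> enat"
  assumes "\<And>n. {x \<in> space M. enat n < f x} \<in> sets M"
  shows "f \<in> measurable M (count_space UNIV)"
proof -
  define F where "F n = {x \<in> space M. enat n < f x}" for n
  have F: "F n \<in> sets M" for n
    unfolding F_def by (rule assms)
  have "f -` {a} \<inter> space M \<in> sets M" for a
  proof (cases a)
    case (enat n)
    have "f x = enat n \<longleftrightarrow> (case n of 0 \<Rightarrow> True | Suc m \<Rightarrow> enat m < f x) \<and> \<not> enat n < f x" for x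
      by (cases "f x") (auto split: nat.split)
    then have "f -` {a} \<inter> space M = (case n of 0 \<Rightarrow> space M | Suc m \<Rightarrow> F m) - F n"
      using enat by (auto simp: F_def split: nat.splits)
    then show ?thesis
      by (cases n) (simp_all only: nat.case, (intro sets.Diff sets.top F)+)
  next
    case infinity
    have "f x = \<infinity> \<longleftrightarrow> (\<forall>k. enat k < f x)" for x
      by (cases "f x") auto
    then have "f -` {a} \<inter> space M = (\<Inter>k. F k)"
      using infinity by (auto simp: F_def)
    then show ?thesis
      by (simp only:) (intro sets.countable_INT image_subsetI F, simp)
  qed
  then show ?thesis
    by (intro measurable_count_space_eq2_countable[THEN iffD2] conjI ballI Pi_I UNIV_I countableI_type)
qed

lemma measurable_hit_time:
  "hit_time v \<in> measurable (nbrw_law adj i) (count_space UNIV)"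
  using sets_avoid[of "{.._}" v]
  by (intro measurable_enatI) (simp only: enat_less_hit_time_iff sets_nbrw_law space_nbrw_law UNIV_I simp_thms Ball_def atMost_iff)

lemma measurable_nbrw_law_coordinate:
  fixes H :: "'v::finite \<Rightarrow> ennreal"
  shows "(\<lambda>\<omega>. H (\<omega> k)) \<in> borel_measurable (nbrw_law adj i)"
proof -
  have "(\<lambda>\<omega>. \<omega> k) \<in> measurable (nbrw_law adj i) (count_space UNIV)"
    unfolding measurable_cong_sets[OF sets_nbrw_law refl]
    by (rule measurable_component_singleton) simp
  then show ?thesis
    by (rule measurable_compose) simp
qed

lemma nn_integral_nbrw_law_survival:
  "(\<integral>\<^sup>+\<omega>. H (\<omega> 0) (\<omega> 1) * indicator {\<omega>. \<forall>k\<in>{1..n}. \<omega> k \<noteq> v} \<omega> \<partial>nbrw_law adj i) =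
    (\<integral>\<^sup>+c. H i c * survival adj v n i c \<partial>measure_pmf (pmf_of_set (nbrs adj i)))"
  using nn_integral_nbrw_law_avoid[where G="\<lambda>_ _. 1"] by (simp add: survival_def)

definition mean_return :: "('v::finite \<Rightarrow> 'v \<Rightarrow> bool) \<Rightarrow> 'v \<Rightarrow> 'v \<Rightarrow> 'v \<Rightarrow> ennreal"
  where "mean_return adj v a b = (\<Sum>n. survival adj v n a b)"

text \<open>First-step analysis: drop the term \<open>n = 0\<close> of the tail series and move the
  remaining sum through the integral, which nonnegativity permits even when it diverges.\<close>

lemma mean_return_eq: "mean_return adj v a b = 1 + avoid_step adj v (mean_return adj v) a b"
proof -
  have "mean_return adj v a b = survival adj v 0 a b + (\<Sum>n. survival adj v (Suc n) a b)"
    unfolding mean_return_def using suminf_offset[of "\<lambda>n. survival adj v n a b" 1] by simp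
  also have "(\<Sum>n. survival adj v (Suc n) a b) = avoid_step adj v (mean_return adj v) a b"
    by (simp add: survival_def avoid_step_def mean_return_def nn_integral_suminf)
  finally show ?thesis
    by (simp add: survival_def)
qed

lemma AE_nbrw_law_start: "AE \<omega> in nbrw_law adj i. \<omega> 0 = i"
proof (rule AE_I)
  have S: "{\<omega>. \<omega> 0 \<noteq> i} \<in> sets (nbrw_law adj i)"
    using sets_avoid[of "{0}" i] by (simp add: sets_nbrw_law)
  have "(\<integral>\<^sup>+\<omega>. indicator (- {i}) (\<omega> 0) \<partial>nbrw_law adj i) = 0"
    by (subst nn_integral_nbrw_law_step[where n=0]) auto
  moreover have "(\<integral>\<^sup>+\<omega>. indicator (- {i}) (\<omega> 0) \<partial>nbrw_law adj i) =
      (\<integral>\<^sup>+\<omega>. indicator {\<omega>. \<omega> 0 \<noteq> i} \<omega> \<partial>nbrw_law adj i)"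
    by (intro nn_integral_cong) (auto simp: indicator_def)
  ultimately show "emeasure (nbrw_law adj i) {\<omega>. \<omega> 0 \<noteq> i} = 0"
    by (simp only: nn_integral_indicator[OF S])
  show "{\<omega>. \<omega> 0 \<noteq> i} \<in> sets (nbrw_law adj i)"
    by (fact S)
qed auto

text \<open>The tail-sum formula for expectations, applied to a constant on a one-point probability
  space.\<close>

lemma ennreal_of_enat_eq_suminf: "ennreal_of_enat x = (\<Sum>n. of_bool (enat n < x))"
proof -
  have "ennreal_of_enat x = (\<integral>\<^sup>+ y. ennreal_of_enat x \<partial>return (count_space UNIV) ())"
    by (simp add: nn_integral_return)
  also have "\<dots> = (\<Sum>n. emeasure (return (count_space UNIV) ()) {y. enat n < x})"
    by (subst nn_integral_enat_function) auto
  also have "\<dots> = (\<Sum>n. of_bool (enat n < x))"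
    by (intro suminf_cong) (simp add: of_bool_def)
  finally show ?thesis .
qed

text \<open>The weight \<open>H\<close> serves two purposes: \<open>H = 1\<close> gives plain
  expectations, and the indicator of a vertex isolates one first step for the conditioned
  law.\<close>

lemma nn_integral_return_time:
  "(\<integral>\<^sup>+\<omega>. H (\<omega> 1) * ennreal_of_enat (return_time v \<omega>) \<partial>nbrw_law adj i) =
    (\<integral>\<^sup>+c. H c * mean_return adj v i c \<partial>measure_pmf (pmf_of_set (nbrs adj i)))"
proof -
  have "(\<integral>\<^sup>+\<omega>. H (\<omega> 1) * ennreal_of_enat (return_time v \<omega>) \<partial>nbrw_law adj i) =
    (\<integral>\<^sup>+\<omega>. (\<Sum>n. H (\<omega> 1) * indicator {\<omega>. \<forall>k\<in>{1..n}. \<omega> k \<noteq> v} \<omega>) \<partial>nbrw_law adj i)"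
    by (intro nn_integral_cong)
       (simp add: ennreal_of_enat_eq_suminf enat_less_return_time_iff of_bool_def indicator_def)
  also have "\<dots> = (\<Sum>n. \<integral>\<^sup>+\<omega>. H (\<omega> 1) * indicator {\<omega>. \<forall>k\<in>{1..n}. \<omega> k \<noteq> v} \<omega> \<partial>nbrw_law adj i)"
    by (intro nn_integral_suminf borel_measurable_times_ennreal borel_measurable_indicator
          measurable_nbrw_law_coordinate) (simp only: sets_nbrw_law sets_avoid)
  also have "\<dots> = (\<Sum>n. \<integral>\<^sup>+c. H c * survival adj v n i c \<partial>measure_pmf (pmf_of_set (nbrs adj i)))"
    using nn_integral_nbrw_law_survival[where H="\<lambda>_. H"] by simp
  also have "\<dots> = (\<integral>\<^sup>+c. H c * mean_return adj v i c \<partial>measure_pmf (pmf_of_set (nbrs adj i)))"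
    by (simp add: mean_return_def flip: nn_integral_suminf)
  finally show ?thesis .
qed

lemma hit_time_eq_return_time: "hit_time v \<omega> = (if \<omega> 0 = v then 0 else return_time v \<omega>)"
proof (cases "\<omega> 0 = v")
  case True
  then show ?thesis
    using enat_less_hit_time_iff[of 0 v \<omega>] by (auto simp: zero_enat_def[symmetric])
next
  case False
  then have "{enat k |k. \<omega> k = v} = {enat k |k. 1 \<le> k \<and> \<omega> k = v}"
    by (auto simp: Suc_le_eq intro: gr0I)
  with False show ?thesis
    by (simp add: hit_time_def return_time_def)
qed

lemma nn_integral_hit_time:
  "(\<integral>\<^sup>+\<omega>. H (\<omega> 1) * ennreal_of_enat (hit_time v \<omega>) \<partial>nbrw_law adj i) =
    (if i = v then 0 else \<integral>\<^sup>+c. H c * mean_return adj v i c \<partial>measure_pmf (pmf_of_set (nbrs adj i)))"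
proof -
  have "(\<integral>\<^sup>+\<omega>. H (\<omega> 1) * ennreal_of_enat (hit_time v \<omega>) \<partial>nbrw_law adj i) =
    (\<integral>\<^sup>+\<omega>. (if i = v then 0 else H (\<omega> 1) * ennreal_of_enat (return_time v \<omega>)) \<partial>nbrw_law adj i)"
    using AE_nbrw_law_start[of i adj]
    by (intro nn_integral_cong_AE) (auto simp: hit_time_eq_return_time elim!: eventually_mono)
  then show ?thesis
    using nn_integral_return_time[where H=H] by auto
qed

text \<open>Both the conditioning event and the integral over it carry the factor one over the
  degree of \<open>i\<close>, which cancels.\<close>

lemma nn_integral_hit_time_nbrw_law2:
  assumes "adj i j"
  shows "(\<integral>\<^sup>+\<omega>. ennreal_of_enat (hit_time v \<omega>) \<partial>nbrw_law2 adj i j) =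
    (if i = v then 0 else mean_return adj v i j)"
proof -
  let ?B = "{\<omega>. \<omega> 0 = i \<and> \<omega> 1 = j}" and ?p = "measure_pmf (pmf_of_set (nbrs adj i))"
  have fin: "finite (nbrs adj i)" and j: "j \<in> nbrs adj i"
    using assms by (auto simp: nbrs_def)
  have p: "(\<integral>\<^sup>+c. indicator {j} c * g c \<partial>?p) = g j / of_nat (card (nbrs adj i))" for g
    using fin j by (subst nn_integral_pmf_of_set) (auto simp: indicator_def if_distrib cong: if_cong)
  have sB: "?B \<in> sets (nbrw_law adj i)"
  proof -
    have "\<omega> 0 = i \<and> \<omega> 1 = j \<longleftrightarrow> (\<forall>k. \<omega> k \<in> (if k = 0 then {i} else if k = 1 then {j} else UNIV))"
      for \<omega> :: "nat \<Rightarrow> 'a"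
      using spec[of "\<lambda>k. \<omega> k \<in> (if k = 0 then {i} else if k = 1 then {j} else UNIV)" 0]
        spec[of "\<lambda>k. \<omega> k \<in> (if k = 0 then {i} else if k = 1 then {j} else UNIV)" 1]
      by (intro iffI allI conjI) simp_all
    then show ?thesis
      by (simp only: sets_PiM_UNIV_coordinates sets_nbrw_law)
  qed
  have "emeasure (nbrw_law adj i) ?B = (\<integral>\<^sup>+\<omega>. indicator ?B \<omega> \<partial>nbrw_law adj i)"
    by (rule nn_integral_indicator[OF sB, symmetric])
  \<comment> \<open>The range \<open>{1..0}\<close> is empty, so this indicator is constantly 1; it
    only brings the integrand into the shape of \<open>nn_integral_nbrw_law_survival\<close> with
    \<open>n = 0\<close>.\<close>
  also have "\<dots> = (\<integral>\<^sup>+\<omega>. indicator {j} (\<omega> 1) * indicator {\<omega>. \<forall>k\<in>{1..0}. \<omega> k \<noteq> v} \<omega> \<partial>nbrw_law adj i)"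
    using AE_nbrw_law_start[of i adj]
    by (intro nn_integral_cong_AE) (auto simp: indicator_def elim!: eventually_mono)
  also have "\<dots> = 1 / of_nat (card (nbrs adj i))"
    by (subst nn_integral_nbrw_law_survival, subst p) (simp add: survival_def)
  finally have B: "emeasure (nbrw_law adj i) ?B = 1 / of_nat (card (nbrs adj i))" .
  have "(\<integral>\<^sup>+\<omega>. ennreal_of_enat (hit_time v \<omega>) \<partial>nbrw_law2 adj i j) =
      (\<integral>\<^sup>+\<omega>. ennreal_of_enat (hit_time v \<omega>) * indicator ?B \<omega> \<partial>nbrw_law adj i) / (1 / of_nat (card (nbrs adj i)))"
    unfolding nbrw_law2_def 
    by (subst nn_integral_uniform_measure)
       (simp_all only: B sB measurable_compose[OF measurable_hit_time] borel_measurable_count_space)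
  also have "(\<integral>\<^sup>+\<omega>. ennreal_of_enat (hit_time v \<omega>) * indicator ?B \<omega> \<partial>nbrw_law adj i) =
      (\<integral>\<^sup>+\<omega>. indicator {j} (\<omega> 1) * ennreal_of_enat (hit_time v \<omega>) \<partial>nbrw_law adj i)"
    using AE_nbrw_law_start[of i adj]
    by (intro nn_integral_cong_AE) (auto simp: indicator_def elim!: eventually_mono)
  also have "\<dots> = (if i = v then 0 else mean_return adj v i j / of_nat (card (nbrs adj i)))"
    using nn_integral_hit_time[where H="indicator {j}"] by (auto simp: p)
  also have "\<dots> / (1 / of_nat (card (nbrs adj i))) = (if i = v then 0 else mean_return adj v i j)"
  proof -
    have "0 < real (card (nbrs adj i))"
      using fin j by (auto simp: card_gt_0_iff)
    moreover have "inverse (ennreal c) * inverse (inverse (ennreal c)) = 1" if "0 < c" for c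
      using that by (simp add: inverse_ennreal flip: ennreal_mult)
    ultimately show ?thesis
      by (simp add: divide_ennreal_def mult.assoc ennreal_of_nat_eq_real_of_nat)
  qed
  finally show ?thesis .
qed


section \<open>Graphs and matrices\<close>

text \<open>The set \<open>S\<close> of states reachable from \<open>f\<close> loses no mass, so its
  rows put mass \<open>card S\<close> inside \<open>S\<close>. Its columns have the same total,
  hence nothing enters from outside, and a path ending in \<open>S\<close> must start there.\<close>

lemma doubly_stochastic_reachable_sym:
  fixes P :: "real^'e^'e"
  assumes nonneg: "\<And>e f. 0 \<le> P $ e $ f"
    and row: "\<And>e. (\<Sum>f\<in>UNIV. P $ e $ f) = 1"
    and col: "\<And>f. (\<Sum>e\<in>UNIV. P $ e $ f) = 1"
    and reach: "(\<lambda>e f. 0 < P $ e $ f)\<^sup>*\<^sup>* e f"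
  shows "(\<lambda>e f. 0 < P $ e $ f)\<^sup>*\<^sup>* f e"
proof -
  define S where "S = {g. (\<lambda>e f. 0 < P $ e $ f)\<^sup>*\<^sup>* f g}"
  have out: "P $ g $ h = 0" if "g \<in> S" "h \<notin> S" for g h
  proof -
    have "\<not> 0 < P $ g $ h"
      using that unfolding S_def by (auto dest: rtranclp.rtrancl_into_rtrancl)
    then show ?thesis
      using nonneg[of g h] by linarith
  qed
  have "(\<Sum>h\<in>S. \<Sum>g\<in>S. P $ g $ h) = (\<Sum>g\<in>S. \<Sum>h\<in>S. P $ g $ h)"
    by (rule sum.swap)
  also have "\<dots> = (\<Sum>g\<in>S. \<Sum>h\<in>UNIV. P $ g $ h)"
    by (intro sum.cong refl sum.mono_neutral_left) (auto simp: out)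
  also have "\<dots> = (\<Sum>h\<in>S. \<Sum>g\<in>UNIV. P $ g $ h)"
    by (simp add: row col)
  also have "\<dots> = (\<Sum>h\<in>S. (\<Sum>g\<in>S. P $ g $ h) + (\<Sum>g\<in>-S. P $ g $ h))"
    by (intro sum.cong refl, subst sum.union_disjoint[symmetric]) auto
  finally have "(\<Sum>h\<in>S. \<Sum>g\<in>-S. P $ g $ h) = 0"
    by (simp add: sum.distrib)
  then have into: "P $ g $ h = 0" if "g \<notin> S" "h \<in> S" for g h
    using that nonneg by (simp add: sum_nonneg_eq_0_iff sum_nonneg)
  from reach have "e \<in> S"
  proof (induction rule: converse_rtranclp_induct)
    case base
    then show ?case by (simp add: S_def)
  next
    case (step y z)
    then show ?case using into[of y z] by force
  qed
  then show ?thesis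
    by (simp add: S_def)
qed

text \<open>Walk without backtracking until the first repeated vertex. Two-regularity forces the
  repetition to be of the starting vertex; the closed walk then contains all neighbours of its
  vertices, and connectedness makes it everything.\<close>

lemma connected_2_regular_imp_cycle:
  fixes adj :: "'v::finite \<Rightarrow> 'v \<Rightarrow> bool"
  assumes sg: "simple_graph adj" and conn: "connected_graph adj" and two: "\<And>v. vdeg adj v = 2"
  shows "cycle_graph adj"
proof -
  have sym: "adj a b \<Longrightarrow> adj b a" and irr: "\<not> adj a a" for a b
    using sg by (auto simp: simple_graph_def symp_def irreflp_def)
  have ex: "\<exists>x. adj b x \<and> x \<noteq> a" for a b
  proof (rule ccontr)
    assume "\<not> ?thesis"
    then have "nbrs adj b \<subseteq> {a}"
      by (auto simp: nbrs_def)
    then have "card (nbrs adj b) \<le> card {a}"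
      by (intro card_mono) auto
    then show False
      using two[of b] by (simp add: vdeg_def)
  qed
  \<comment> \<open>Dependent choice runs over directed edges, because the next vertex depends on
    the last two.\<close>
  have "\<exists>f :: nat \<Rightarrow> 'v \<times> 'v. \<forall>n. adj (fst (f n)) (snd (f n)) \<and>
      (fst (f (Suc n)) = snd (f n) \<and> snd (f (Suc n)) \<noteq> fst (f n))"
  proof (rule dependent_nat_choice)
    show "\<exists>x :: 'v \<times> 'v. adj (fst x) (snd x)"
      using ex by (metis fst_conv snd_conv)
    show "\<exists>y. adj (fst y) (snd y) \<and> fst y = snd x \<and> snd y \<noteq> fst x" for x :: "'v \<times> 'v" and n :: nat
      using ex[of "snd x" "fst x"] by auto
  qed
  then obtain f :: "nat \<Rightarrow> 'v \<times> 'v" where f: "\<And>n. adj (fst (f n)) (snd (f n))"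
      "\<And>n. fst (f (Suc n)) = snd (f n)" "\<And>n. snd (f (Suc n)) \<noteq> fst (f n)"
    by blast
  define c where "c n = fst (f n)" for n
  have adjc: "adj (c n) (c (Suc n))" and ne: "c (Suc (Suc n)) \<noteq> c n" for n
    using f(1)[of n] f(2)[of n] f(3)[of n] f(2)[of "Suc n"] by (auto simp: c_def)
  have nb: "adj b x \<longleftrightarrow> x = a \<or> x = a'" if "adj b a" "adj b a'" "a \<noteq> a'" for a a' b x
  proof -
    have "{a, a'} = nbrs adj b"
      using that two[of b] by (intro card_subset_eq) (auto simp: nbrs_def vdeg_def)
    then show ?thesis by (auto simp: nbrs_def)
  qed
  have nbc: "adj (c (Suc n)) x \<longleftrightarrow> x = c n \<or> x = c (Suc (Suc n))" for n x
    using nb[of "c (Suc n)" "c n" "c (Suc (Suc n))" x] adjc[of n] adjc[of "Suc n"] sym ne[of n] by metis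
  have "\<not> inj c"
    using finite_imageD[of c UNIV] by (metis finite infinite_UNIV_nat)
  then obtain j0 i0 where "i0 < j0" "c i0 = c j0"
    unfolding inj_def by (metis linorder_neqE_nat)
  then have "\<exists>j. \<exists>i<j. c i = c j" by blast
  then obtain j where j: "\<exists>i<j. c i = c j" and min: "\<And>k. k < j \<Longrightarrow> \<not> (\<exists>i<k. c i = c k)"
    using exists_least_iff[of "\<lambda>j. \<exists>i<j. c i = c j"] by auto
  from j obtain i where i: "i < j" "c i = c j" by blast
  have inj: "a = b" if "a < j" "b < j" "c a = c b" for a b
    using that min[of a] min[of b] by (metis linorder_neqE_nat)
  \<comment> \<open>Loops and immediate reversals are excluded, so the repetition closes at least
    three steps.\<close>
  have "Suc i \<noteq> j"
    using adjc[of i] irr i by auto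
  then have "Suc i < j"
    using i by simp
  moreover have "Suc (Suc i) \<noteq> j"
    using ne[of i] i by auto
  ultimately have ij: "Suc (Suc i) < j"
    by simp
  have jj: "adj (c j) (c (j - 1))"
    using adjc[of "j - 1"] ij sym by auto
  \<comment> \<open>A repeated vertex with a predecessor \<open>c k\<close> would have
    \<open>c (j - 1)\<close> as a neighbour besides \<open>c k\<close> and
    \<open>c (Suc (Suc k))\<close>, distinct from both by minimality of \<open>j\<close>.\<close>
  have i0: "i = 0"
  proof (cases i)
    case (Suc k)
    have "c (j - 1) = c k \<or> c (j - 1) = c (Suc (Suc k))"
      using jj i(2) nbc[of k] Suc by auto
    then have "j - 1 = k \<or> j - 1 = Suc (Suc k)"
      using inj[of "j - 1" k] inj[of "j - 1" "Suc (Suc k)"] ij Suc by auto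
    then show ?thesis using ij Suc by auto
  qed
  have j3: "3 \<le> j" and cj: "c j = c 0"
    using ij i i0 by auto
  have nb0: "adj (c 0) x \<longleftrightarrow> x = c (j - 1) \<or> x = c 1" for x
  proof (rule nb)
    show "c (j - 1) \<noteq> c 1"
      using inj[of "j - 1" 1] j3 by auto
  qed (use jj cj adjc[of 0] in auto)
  have nbj: "adj (c a) x \<longleftrightarrow> x = c (if a = 0 then j - 1 else a - 1) \<or> x = c (if Suc a = j then 0 else Suc a)"
    if "a < j" for a x
    using that nb0[of x] nbc[of "a - 1" x] j3 cj by (cases a) auto
  have reach: "v \<in> c ` {..<j}" if "adj\<^sup>*\<^sup>* (c 0) v" for v
    using that
  proof (induction rule: rtranclp_induct)
    case base
    then show ?case using j3 by auto
  next
    case (step y z)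
    then obtain a where a: "a < j" "y = c a" by auto
    then show ?case
      using step nbj[of a z] j3 by (auto split: if_splits)
  qed
  have bij: "bij_betw c {..<j} UNIV"
    using inj reach conn unfolding bij_betw_def inj_on_def connected_graph_def by blast
  then have j_card: "j = CARD('v)"
    using bij_betw_same_card by fastforce
  have "adj (c a) (c b) \<longleftrightarrow> b = (a + 1) mod j \<or> a = (b + 1) mod j" if ab: "a < j" "b < j" for a b
  proof -
    have m: "(x + 1) mod j = (if Suc x = j then 0 else Suc x)" if "x < j" for x
      using that by auto
    have "adj (c a) (c b) \<longleftrightarrow> b = (if a = 0 then j - 1 else a - 1) \<or> b = (if Suc a = j then 0 else Suc a)"
      using nbj[OF ab(1), of "c b"] ab j3 inj[of b] by (smt (verit) One_nat_def Suc_lessI diff_less gr0I less_imp_diff_less zero_less_Suc)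
    then show ?thesis
      unfolding m[OF ab(1)] m[OF ab(2)] using ab j3 by (auto split: if_splits)
  qed
  then show ?thesis
    unfolding cycle_graph_def using j3 bij j_card by blast
qed

text \<open>Forgetting orientation has fibres of size exactly two, the two orientations being
  distinct because there are no loops.\<close>

lemma card_dir_edges:
  fixes adj :: "'v::finite \<Rightarrow> 'v \<Rightarrow> bool"
  assumes "simple_graph adj"
  shows "card (dir_edges adj) = 2 * num_edges adj"
proof -
  have sym: "adj a b \<Longrightarrow> adj b a" and irr: "\<not> adj a a" for a b
    using assms by (auto simp: simple_graph_def symp_def irreflp_def)
  let ?f = "\<lambda>p. {fst p, snd p}"
  have img: "?f ` dir_edges adj = {{u, v} |u v. adj u v}"
    by (force simp: dir_edges_def image_def)
  have "card (dir_edges adj) = (\<Sum>y\<in>?f ` dir_edges adj. card {p \<in> dir_edges adj. ?f p = y})"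
    using sum.image_gen[of "dir_edges adj" "\<lambda>_. 1 :: nat" ?f] by simp
  also have "\<dots> = (\<Sum>y\<in>?f ` dir_edges adj. 2)"
  proof (rule sum.cong[OF refl])
    fix y assume "y \<in> ?f ` dir_edges adj"
    then obtain u v where uv: "adj u v" "y = {u, v}"
      by (auto simp: dir_edges_def)
    then have "{p \<in> dir_edges adj. ?f p = y} = {(u, v), (v, u)}"
      using sym by (auto simp: dir_edges_def doubleton_eq_iff)
    moreover have "u \<noteq> v"
      using uv irr by auto
    ultimately show "card {p \<in> dir_edges adj. ?f p = y} = 2"
      by simp
  qed
  finally show ?thesis
    unfolding img num_edges_def by simp
qed

section \<open>Matrix algebra and inverses of diagonal matrices\<close>

lemma matrix_sub_ldistrib: "A ** (B - C) = A ** B - A ** C"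
  for A :: "real^'n^'m" and B C :: "real^'p^'n"
  by (simp add: vec_eq_iff matrix_matrix_mult_def right_diff_distrib sum_subtractf)

lemma matrix_add_rdistrib: "(A + B) ** C = A ** C + B ** C"
  for A B :: "real^'n^'m" and C :: "real^'p^'n"
  by (simp add: vec_eq_iff matrix_matrix_mult_def distrib_right sum.distrib)

lemma matrix_sub_rdistrib: "(A - B) ** C = A ** C - B ** C"
  for A B :: "real^'n^'m" and C :: "real^'p^'n"
  by (simp add: vec_eq_iff matrix_matrix_mult_def left_diff_distrib sum_subtractf)

lemma matrix_inv_left: "invertible A \<Longrightarrow> matrix_inv A ** A = mat 1"
  for A :: "real^'n^'n"
  unfolding matrix_inv_def invertible_def by (metis (mono_tags, lifting) someI_ex)

lemma matrix_inv_eqI: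
  fixes A B :: "real^'n^'n"
  assumes "A ** B = mat 1"
  shows "matrix_inv A = B"
proof -
  have inv: "invertible A"
    using assms by (auto simp: invertible_right_inverse)
  have "matrix_inv A = matrix_inv A ** (A ** B)"
    by (simp add: assms)
  also have "\<dots> = B"
    using matrix_inv_left[OF inv] by (simp add: matrix_mul_assoc)
  finally show ?thesis .
qed

lemma diag_mat_mult: "(diag_mat f ** X) $ i $ j = f i * X $ i $ j"
  by (simp add: diag_mat_def matrix_matrix_mult_def if_distrib[of "\<lambda>x. x * _"] sum.delta' cong: if_cong)

lemma mult_diag_mat: "(X ** diag_mat f) $ i $ j = X $ i $ j * f j"
  by (simp add: diag_mat_def matrix_matrix_mult_def if_distrib[of "\<lambda>x. _ * x"] sum.delta cong: if_cong)

lemma matrix_inv_diag_mat: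
  assumes "\<And>i. f i \<noteq> 0"
  shows "matrix_inv (diag_mat f) = diag_mat (\<lambda>i. 1 / f i)"
  by (rule matrix_inv_eqI) (simp add: vec_eq_iff diag_mat_mult, simp add: diag_mat_def mat_def assms)


section \<open>Irreducibility of the walk on directed edges\<close>

locale nb_graph =
  fixes adj :: "'v::finite \<Rightarrow> 'v \<Rightarrow> bool" and de :: "'e::finite \<Rightarrow> 'v \<times> 'v"
  assumes simple: "simple_graph adj" and connected: "connected_graph adj"
    and min_deg: "\<And>v. 2 \<le> vdeg adj v" and no_cycle: "\<not> cycle_graph adj"
    and indexes: "indexes_dir_edges adj de"
begin

abbreviation "d v \<equiv> real (vdeg adj v)"
abbreviation "P \<equiv> P_nb adj de"
abbreviation "ix a b \<equiv> inv de (a, b)"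

lemma adj_sym: "adj a b \<Longrightarrow> adj b a"
  using simple by (auto simp: simple_graph_def symp_def irreflp_def)

lemma d_ge_2: "2 \<le> d v"
  using min_deg[of v] by simp

lemma bij_de: "bij_betw de UNIV (dir_edges adj)"
  using indexes by (simp add: indexes_dir_edges_def)

lemma de_adj: "adj (fst (de e)) (snd (de e))"
  using bij_de by (auto simp: bij_betw_def dir_edges_def set_eq_iff image_iff split: prod.splits)
    (metis prod.collapse)

lemma inj_de: "de e = de f \<longleftrightarrow> e = f"
  using bij_de by (auto simp: bij_betw_def inj_def)

lemma de_ix: "adj a b \<Longrightarrow> de (ix a b) = (a, b)"
  using bij_de by (intro f_inv_into_f) (auto simp: bij_betw_def dir_edges_def)

text \<open>Out-edges of \<open>b\<close> correspond to neighbours through their heads, with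
  \<open>ix b\<close> as inverse; this transfers sums from edge indices to vertices.\<close>

lemma sum_out_edges: "(\<Sum>f | fst (de f) = b. g (de f)) = (\<Sum>l\<in>nbrs adj b. g (b, l))"
proof (rule sum.reindex_bij_betw[of "\<lambda>f. snd (de f)" _ _ "\<lambda>l. g (b, l)", THEN trans[rotated]])
  show "bij_betw (\<lambda>f. snd (de f)) {f. fst (de f) = b} (nbrs adj b)"
  proof (rule bij_betw_byWitness[where f'="\<lambda>l. ix b l"])
    show "\<forall>a\<in>{f. fst (de f) = b}. ix b (snd (de a)) = a"
      using inj_de by (auto simp: inj_def intro!: inv_f_eq)
    show "(\<lambda>f. snd (de f)) ` {f. fst (de f) = b} \<subseteq> nbrs adj b"
      using de_adj by (auto simp: nbrs_def)
  qed (auto simp: nbrs_def de_ix)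
qed (auto intro!: sum.cong)

lemma P_entry: "P $ e $ f = (if snd (de e) = fst (de f) \<and> snd (de f) \<noteq> fst (de e)
    then 1 / (d (snd (de e)) - 1) else 0)"
  by (auto simp: P_nb_def split: prod.split)

lemma P_nonneg: "0 \<le> P $ e $ f"
  using d_ge_2[of "snd (de e)"] by (auto simp: P_entry)

lemma P_pos: "adj a b \<Longrightarrow> adj b c \<Longrightarrow> c \<noteq> a \<Longrightarrow> 0 < P $ ix a b $ ix b c"
  using d_ge_2[of b] by (auto simp: P_entry de_ix)

lemma sum_P: "(\<Sum>f\<in>UNIV. P $ e $ f * g (de f)) =
    (\<Sum>l\<in>nbrs adj (snd (de e)) - {fst (de e)}. g (snd (de e), l)) / (d (snd (de e)) - 1)"
proof -
  let ?a = "fst (de e)" and ?b = "snd (de e)"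
  have "(\<Sum>f\<in>UNIV. P $ e $ f * g (de f)) =
      (\<Sum>f | fst (de f) = ?b. (\<lambda>p. if snd p \<noteq> ?a then g p / (d ?b - 1) else 0) (de f))"
    by (intro sum.mono_neutral_cong_right) (auto simp: P_entry)
  also have "\<dots> = (\<Sum>l\<in>nbrs adj ?b. if l \<noteq> ?a then g (?b, l) / (d ?b - 1) else 0)"
    by (subst sum_out_edges) simp
  also have "\<dots> = (\<Sum>l\<in>nbrs adj ?b - {?a}. g (?b, l) / (d ?b - 1))"
    by (intro sum.mono_neutral_cong_right) auto
  finally show ?thesis
    by (simp add: sum_divide_distrib)
qed

lemma card_nbrs_Diff: "adj b a \<Longrightarrow> real (card (nbrs adj b - {a})) = d b - 1"
  using min_deg[of b] by (subst card_Diff_singleton) (auto simp: nbrs_def vdeg_def)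

lemma P_row: "(\<Sum>f\<in>UNIV. P $ e $ f) = 1"
  using sum_P[of e "\<lambda>_. 1"] de_adj[of e] d_ge_2[of "snd (de e)"]
  by (simp add: card_nbrs_Diff adj_sym)

definition rev_ix where "rev_ix e = ix (snd (de e)) (fst (de e))"

lemma de_rev: "de (rev_ix e) = (snd (de e), fst (de e))"
  unfolding rev_ix_def using de_adj[of e] by (simp add: de_ix adj_sym)

lemma rev_rev: "rev_ix (rev_ix e) = e"
  by (simp add: inj_de[symmetric] de_rev)

lemma bij_rev: "bij rev_ix"
  by (metis bijI' rev_rev)

text \<open>Reversal symmetry: the entry of \<open>P\<close> at \<open>(rev_ix e, f)\<close> equals
  the one at \<open>(rev_ix f, e)\<close>, so column sums turn into row sums.\<close>

lemma P_col: "(\<Sum>e\<in>UNIV. P $ e $ f) = 1"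
proof -
  have "(\<Sum>e\<in>UNIV. P $ e $ f) = (\<Sum>e\<in>UNIV. P $ rev_ix e $ f)"
    using sum.reindex_bij_betw[OF bij_rev, of "\<lambda>e. P $ e $ f"] by simp
  also have "\<dots> = (\<Sum>e\<in>UNIV. P $ rev_ix f $ e)"
    by (intro sum.cong) (auto simp: P_entry de_rev)
  finally show ?thesis
    by (simp add: P_row)
qed

definition reach where "reach = (\<lambda>e f. 0 < P $ e $ f)\<^sup>*\<^sup>*"

lemma reach_trans: "reach e f \<Longrightarrow> reach f g \<Longrightarrow> reach e g"
  unfolding reach_def by (rule rtranclp_trans)

lemma reach_sym: "reach e f \<Longrightarrow> reach f e"
  unfolding reach_def by (rule doubly_stochastic_reachable_sym[OF P_nonneg P_row P_col])

lemma reach_step: "adj a b \<Longrightarrow> adj b c \<Longrightarrow> c \<noteq> a \<Longrightarrow> reach (ix a b) (ix b c)"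
  unfolding reach_def by (intro r_into_rtranclp P_pos)

lemma ex_deg_3: "\<exists>w. 3 \<le> vdeg adj w"
proof (rule ccontr)
  assume "\<not> ?thesis"
  then have "vdeg adj v = 2" for v
    using min_deg[of v] by (metis One_nat_def Suc_1 le_antisym not_less_eq_eq numeral_3_eq_3)
  then show False
    using connected_2_regular_imp_cycle[OF simple connected] no_cycle by blast
qed

lemma ex_nbr_avoiding:
  assumes "card S < vdeg adj w"
  shows "\<exists>l. adj w l \<and> l \<notin> S"
proof (rule ccontr)
  assume "\<not> ?thesis"
  then have "nbrs adj w \<subseteq> S"
    by (auto simp: nbrs_def)
  then have "card (nbrs adj w) \<le> card S"
    by (intro card_mono) auto
  then show False
    using assms by (simp add: vdeg_def)
qed

text \<open>Reachability is symmetric, so it is enough to place every edge in the class of a single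
  edge pointing at a vertex \<open>w\<close> of degree at least three.\<close>

lemma irreducible: "reach e f"
proof -
  obtain w where w: "3 \<le> vdeg adj w"
    using ex_deg_3 by blast
  obtain x0 where x0: "adj w x0"
    using ex_nbr_avoiding[of "{}" w] w by auto
  let ?e0 = "ix x0 w"
  \<comment> \<open>A third neighbour \<open>l\<close> makes \<open>(w, l)\<close> a common
    successor of both edges into \<open>w\<close>.\<close>
  have in_w: "reach ?e0 (ix x w)" if x: "adj w x" for x
  proof -
    obtain l where l: "adj w l" "l \<notin> {x0, x}"
      using ex_nbr_avoiding[of "{x0, x}" w] w card_insert_le_m1[of 2 "{x}" x0] by auto
    then have "reach ?e0 (ix w l)" "reach (ix x w) (ix w l)"
      using x x0 by (auto intro!: reach_step adj_sym)
    then show ?thesis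
      by (meson reach_sym reach_trans)
  qed
  have at_w: "reach ?e0 (ix w x) \<and> reach ?e0 (ix x w)" if x: "adj w x" for x
  proof -
    obtain l where l: "adj w l" "l \<notin> {x}"
      using ex_nbr_avoiding[of "{x}" w] w by auto
    then have "reach (ix l w) (ix w x)"
      using x by (auto intro!: reach_step adj_sym)
    then show ?thesis
      using in_w[OF l(1)] in_w[OF x] by (meson reach_trans)
  qed
  \<comment> \<open>Induction along a path from \<open>w\<close>: the edge \<open>(u, u')\<close>
    leads to \<open>(u', x)\<close>, and \<open>(x, u')\<close> leads to \<open>(u', u)\<close>,
    which symmetry reverses.\<close>
  have all: "\<forall>x. adj u x \<longrightarrow> reach ?e0 (ix u x) \<and> reach ?e0 (ix x u)" for u
  proof -
    have "adj\<^sup>*\<^sup>* w u"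
      using connected by (simp add: connected_graph_def)
    then show ?thesis
    proof (induction rule: rtranclp_induct)
      case base
      then show ?case using at_w by blast
    next
      case (step u u')
      show ?case
      proof (intro allI impI)
        fix x assume x: "adj u' x"
        show "reach ?e0 (ix u' x) \<and> reach ?e0 (ix x u')"
        proof (cases "x = u")
          case True
          then show ?thesis using step by blast
        next
          case False
          then have "reach (ix u u') (ix u' x)" "reach (ix x u') (ix u' u)"
            using step x by (auto intro!: reach_step adj_sym)
          then show ?thesis
            using step by (meson reach_sym reach_trans)
        qed
      qed
    qed
  qed
  have "reach ?e0 g" for g
  proof -
    have "ix (fst (de g)) (snd (de g)) = g"
      using inj_de by (simp add: inj_def)
    then show ?thesis
      using all[of "fst (de g)"] de_adj[of g] by metis
  qed
  then show ?thesis
    by (meson reach_sym reach_trans)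
qed


section \<open>Hitting times and the fundamental matrix\<close>

abbreviation "two_m \<equiv> 2 * real (num_edges adj)"

lemma CARD_e: "real CARD('e) = two_m"
  using bij_betw_same_card[OF bij_de] card_dir_edges[OF simple] by simp

lemma two_m_pos: "0 < two_m"
  unfolding CARD_e[symmetric] by simp

text \<open>Maximum principle: at a maximum the averaged deficit from \<open>m\<close> is at most
  zero, so the maximum spreads along positive entries of \<open>P\<close>, that is,
  everywhere.\<close>

lemma subharmonic_constant:
  assumes sub: "\<And>e. x e \<le> (\<Sum>f\<in>UNIV. P $ e $ f * x f)"
  shows "x e = x f"
proof -
  define m where "m = Max (range x)"
  have le: "x g \<le> m" for g
    by (simp add: m_def)
  have "m \<in> range x"
    unfolding m_def by (rule Max_in) auto
  then obtain e0 where e0: "x e0 = m"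
    by auto
  have "x g = m" for g
    using irreducible[of e0 g] unfolding reach_def
  proof (induction rule: rtranclp_induct)
    case (step g h)
    have "(\<Sum>f\<in>UNIV. P $ g $ f * (m - x f)) = m - (\<Sum>f\<in>UNIV. P $ g $ f * x f)"
      by (simp add: right_diff_distrib sum_subtractf sum_distrib_right[symmetric] P_row)
    also have "\<dots> \<le> 0"
      using sub[of g] step by simp
    finally have "(\<Sum>f\<in>UNIV. P $ g $ f * (m - x f)) = 0"
      using le P_nonneg by (intro antisym sum_nonneg) auto
    then have "P $ g $ h * (m - x h) = 0"
      using le P_nonneg by (subst (asm) sum_nonneg_eq_0_iff) auto
    then show ?case
      using step by auto
  qed (rule e0)
  then show ?thesis by simp
qed

abbreviation "W \<equiv> W_e adj :: real^'e^'e"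
abbreviation "Z \<equiv> Z_e adj de"

lemma W_entry: "W $ e $ f = 1 / two_m"
  by (simp add: W_e_def pi_e_def)

text \<open>Summing the kernel equations over all edges cancels \<open>P\<close> by its column sums
  and shows that \<open>x\<close> has sum zero. Then \<open>x\<close> is harmonic, hence constant,
  hence zero.\<close>

lemma invertible_fundamental: "invertible (mat 1 - P + W)"
  unfolding invertible_left_inverse matrix_left_invertible_ker
proof (intro allI impI)
  fix x :: "real^'e" assume "(mat 1 - P + W) *v x = 0"
  then have *: "x $ e - (\<Sum>f\<in>UNIV. P $ e $ f * x $ f) + (\<Sum>f\<in>UNIV. x $ f) / two_m = 0" for e
    by (simp add: matrix_vector_mult_diff_rdistrib matrix_vector_mult_add_rdistrib vec_eq_iff)
       (simp add: matrix_vector_mult_def W_entry sum_divide_distrib)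
  have "(\<Sum>e\<in>UNIV. \<Sum>f\<in>UNIV. P $ e $ f * x $ f) = (\<Sum>f\<in>UNIV. x $ f)"
    by (subst sum.swap) (simp add: sum_distrib_right[symmetric] P_col)
  moreover have "(\<Sum>e\<in>UNIV. x $ e - (\<Sum>f\<in>UNIV. P $ e $ f * x $ f) + (\<Sum>f\<in>UNIV. x $ f) / two_m) = 0"
    using * by simp
  ultimately have s0: "(\<Sum>f\<in>UNIV. x $ f) = 0"
    using two_m_pos by (simp add: sum.distrib sum_subtractf CARD_e)
  have const: "x $ e = x $ f" for e f
  proof (rule subharmonic_constant[of "\<lambda>e. x $ e"])
    show "x $ e \<le> (\<Sum>f\<in>UNIV. P $ e $ f * x $ f)" for e
      using *[of e] s0 by simp
  qed
  have "x $ e = 0" for e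
  proof -
    have "(\<Sum>f\<in>UNIV. x $ f) = (\<Sum>f\<in>(UNIV :: 'e set). x $ e)"
      by (intro sum.cong refl const)
    also have "\<dots> = two_m * x $ e"
      by (simp add: CARD_e)
    finally have "(\<Sum>f\<in>UNIV. x $ f) = two_m * x $ e" .
    then show ?thesis
      using s0 two_m_pos by simp
  qed
  then show "x = 0"
    by (simp add: vec_eq_iff)
qed

lemma P_mult_W: "P ** W = W"
  by (simp add: vec_eq_iff matrix_matrix_mult_def W_entry sum_divide_distrib[symmetric] P_row)

lemma W_mult_W: "W ** W = W"
  using two_m_pos by (simp add: vec_eq_iff matrix_matrix_mult_def W_entry CARD_e)

lemma Z_left: "Z ** (mat 1 - P + W) = mat 1"
  unfolding Z_e_def by (rule matrix_inv_left[OF invertible_fundamental])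

text \<open>Left multiplication by the matrix inverted in \<open>Z\<close> fixes \<open>W\<close>,
  so multiplication by its inverse does too.\<close>

lemma Z_mult_W: "Z ** W = W"
proof -
  have "Z ** ((mat 1 - P + W) ** W) = W"
    by (simp add: matrix_mul_assoc Z_left)
  then show ?thesis
    by (simp add: matrix_add_rdistrib matrix_sub_rdistrib P_mult_W W_mult_W)
qed

lemma Z_mult_Laplacian: "Z ** (mat 1 - P) = mat 1 - W"
  using Z_left by (simp add: matrix_add_ldistrib Z_mult_W eq_diff_eq)

section \<open>Finiteness of the mean return times\<close>

primrec edge_survival :: "'v \<Rightarrow> nat \<Rightarrow> 'e \<Rightarrow> real" where
  "edge_survival v 0 e = 1"
| "edge_survival v (Suc n) e = (if snd (de e) = v then 0 else \<Sum>f\<in>UNIV. P $ e $ f * edge_survival v n f)"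

lemma edge_survival_bounds: "0 \<le> edge_survival v n e \<and> edge_survival v n e \<le> 1"
proof (induction n arbitrary: e)
  case (Suc n)
  have "(\<Sum>f\<in>UNIV. P $ e $ f * edge_survival v n f) \<le> (\<Sum>f\<in>UNIV. P $ e $ f)"
    using Suc P_nonneg by (intro sum_mono mult_left_le) auto
  moreover have "0 \<le> (\<Sum>f\<in>UNIV. P $ e $ f * edge_survival v n f)"
    using Suc P_nonneg by (intro sum_nonneg) auto
  ultimately show ?case
    by (simp add: P_row)
qed simp

lemma ix_de: "inv de (de f) = f"
  using inj_de by (simp add: inj_def)

text \<open>The link between probability and matrices: one step of the walk after the edge
  \<open>e\<close> is the row \<open>e\<close> of \<open>P\<close>.\<close>

lemma nn_integral_nb_step:
  assumes G: "\<And>f. G (fst (de f)) (snd (de f)) = ennreal (g f)" and nonneg: "\<And>f. 0 \<le> g f"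
  shows "(\<integral>\<^sup>+c. G (snd (de e)) c \<partial>measure_pmf (pmf_of_set (nbrs adj (snd (de e)) - {fst (de e)}))) =
    ennreal (\<Sum>f\<in>UNIV. P $ e $ f * g f)"
proof -
  let ?b = "snd (de e)" and ?S = "nbrs adj (snd (de e)) - {fst (de e)}"
  have c: "real (card ?S) = d ?b - 1"
    by (rule card_nbrs_Diff[OF adj_sym[OF de_adj]])
  then have pos: "0 < real (card ?S)"
    using d_ge_2[of ?b] by simp
  then have ne: "?S \<noteq> {}"
    by (metis card.empty of_nat_0 less_irrefl)
  have "(\<integral>\<^sup>+c. G ?b c \<partial>measure_pmf (pmf_of_set ?S)) = (\<Sum>c\<in>?S. G ?b c) / of_nat (card ?S)"
    using ne by (subst nn_integral_pmf_of_set) auto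
  also have "(\<Sum>c\<in>?S. G ?b c) = (\<Sum>c\<in>?S. ennreal (g (ix ?b c)))"
    by (intro sum.cong refl) (simp add: G[symmetric] de_ix nbrs_def)
  also have "\<dots> / of_nat (card ?S) = ennreal ((\<Sum>c\<in>?S. g (ix ?b c)) / real (card ?S))"
    using pos nonneg by (simp only: sum_ennreal ennreal_of_nat_eq_real_of_nat divide_ennreal sum_nonneg)
  also have "\<dots> = ennreal (\<Sum>f\<in>UNIV. P $ e $ f * g f)"
    using sum_P[of e "\<lambda>p. g (inv de p)"] by (simp only: c ix_de)
  finally show ?thesis .
qed

text \<open>The two recursions agree step by step; the real-valued copy on edge indices is what
  linear algebra can be applied to.\<close>

lemma survival_eq_edge_survival: "survival adj v n (fst (de e)) (snd (de e)) = ennreal (edge_survival v n e)"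
proof (induction n arbitrary: e)
  case 0
  then show ?case by (simp add: survival_def)
next
  case (Suc n)
  have "survival adj v (Suc n) = avoid_step adj v (survival adj v n)"
    by (simp add: survival_def)
  then show ?case
    using nn_integral_nb_step[of "survival adj v n" "edge_survival v n" e] Suc edge_survival_bounds
    by (simp add: avoid_step_def)
qed

text \<open>
  With \<open>A\<close> the substochastic matrix of the walk killed at \<open>v\<close>, the partial sums \<open>S\<^sub>n\<close> of \<open>A\<^sup>k 1\<close> satisfy
  \<open>(I - A) S\<^sub>n = 1 - A\<^sup>n 1\<close>, and \<open>I - A\<close> is invertible.
\<close>

lemma edge_survival_sum_bounded: "\<exists>K. \<forall>n e. (\<Sum>k<n. edge_survival v k e) \<le> K"
proof -
  define A :: "real^'e^'e" where "A = (\<chi> e f. if snd (de e) = v then 0 else P $ e $ f)"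
  have A_mult: "(A *v x) $ e = (if snd (de e) = v then 0 else \<Sum>f\<in>UNIV. P $ e $ f * x $ f)" for x e
    by (simp add: A_def matrix_vector_mult_def)
  have "\<forall>x. (mat 1 - A) *v x = 0 \<longrightarrow> x = 0"
  proof (intro allI impI)
    fix x assume "(mat 1 - A) *v x = 0"
    then have x: "x $ e = (if snd (de e) = v then 0 else \<Sum>f\<in>UNIV. P $ e $ f * x $ f)" for e
      by (simp add: matrix_vector_mult_diff_rdistrib vec_eq_iff A_mult)
    \<comment> \<open>At killed edges \<open>x\<close> vanishes, so taking absolute values gives a
      function subharmonic for \<open>P\<close> itself and not only for \<open>A\<close>.\<close>
    have const: "\<bar>x $ e\<bar> = \<bar>x $ f\<bar>" for e f
    proof (rule subharmonic_constant[of "\<lambda>e. \<bar>x $ e\<bar>"])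
      fix e
      have "\<bar>\<Sum>f\<in>UNIV. P $ e $ f * x $ f\<bar> \<le> (\<Sum>f\<in>UNIV. P $ e $ f * \<bar>x $ f\<bar>)"
        by (rule sum_abs[THEN order_trans]) (simp add: abs_mult P_nonneg)
      moreover have "0 \<le> (\<Sum>f\<in>UNIV. P $ e $ f * \<bar>x $ f\<bar>)"
        by (intro sum_nonneg) (simp add: P_nonneg)
      ultimately show "\<bar>x $ e\<bar> \<le> (\<Sum>f\<in>UNIV. P $ e $ f * \<bar>x $ f\<bar>)"
        by (subst x) auto
    qed
    \<comment> \<open>The constant is zero because an edge pointing into \<open>v\<close> is
      killed.\<close>
    obtain w where "adj v w"
      using ex_nbr_avoiding[of "{}" v] min_deg[of v] by auto
    then have "x $ ix w v = 0"
      by (subst x) (simp add: de_ix adj_sym)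
    then have "x $ e = 0" for e
      using const[of e "ix w v"] by simp
    then show "x = 0"
      by (simp add: vec_eq_iff)
  qed
  then obtain C :: "real^'e^'e" where C: "C ** (mat 1 - A) = mat 1"
    using matrix_left_invertible_ker[of "mat 1 - A"] by blast
  \<comment> \<open>The right-hand side of the linear system has entries between 0 and 1, so the
    total absolute mass of \<open>C\<close> bounds the solution.\<close>
  have bound: "(\<Sum>k<n. edge_survival v k e) \<le> (\<Sum>e\<in>UNIV. \<Sum>f\<in>UNIV. \<bar>C $ e $ f\<bar>)" for n e
  proof -
    define S :: "real^'e" where "S = (\<chi> e. \<Sum>k<n. edge_survival v k e)"
    have "((mat 1 - A) *v S) $ e = 1 - edge_survival v n e" for e
    proof -
      have "(A *v S) $ e = (\<Sum>k<n. edge_survival v (Suc k) e)"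
        by (simp add: A_mult S_def sum_distrib_left sum.swap[of _ UNIV])
      moreover have "(\<Sum>k<n. edge_survival v k e) - (\<Sum>k<n. edge_survival v (Suc k) e) = edge_survival v 0 e - edge_survival v n e"
        unfolding sum_subtractf[symmetric] by (rule sum_lessThan_telescope'[of "\<lambda>k. edge_survival v k e"])
      ultimately show ?thesis
        by (simp add: matrix_vector_mult_diff_rdistrib S_def)
    qed
    then have "(mat 1 - A) *v S = (\<chi> e. 1 - edge_survival v n e)"
      by (simp add: vec_eq_iff)
    then have "S = C *v (\<chi> e. 1 - edge_survival v n e)"
      by (metis C matrix_vector_mul_assoc matrix_vector_mul_lid)
    then have "S $ e = (\<Sum>f\<in>UNIV. C $ e $ f * (1 - edge_survival v n f))"
      by (simp add: matrix_vector_mult_def)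
    also have "\<dots> \<le> (\<Sum>f\<in>UNIV. \<bar>C $ e $ f\<bar>)"
    proof (rule sum_mono)
      fix f
      have "C $ e $ f * (1 - edge_survival v n f) \<le> \<bar>C $ e $ f\<bar> * (1 - edge_survival v n f)"
        using edge_survival_bounds[of v n f] by (intro mult_right_mono) auto
      also have "\<dots> \<le> \<bar>C $ e $ f\<bar>"
        using edge_survival_bounds[of v n f] by (intro mult_left_le) auto
      finally show "C $ e $ f * (1 - edge_survival v n f) \<le> \<bar>C $ e $ f\<bar>" .
    qed
    also have "\<dots> \<le> (\<Sum>e\<in>UNIV. \<Sum>f\<in>UNIV. \<bar>C $ e $ f\<bar>)"
      by (rule member_le_sum[where f="\<lambda>e. \<Sum>f\<in>UNIV. \<bar>C $ e $ f\<bar>"]) (auto intro: sum_nonneg)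
    finally show ?thesis
      by (simp add: S_def)
  qed
  then show ?thesis
    by blast
qed

definition edge_return :: "'e \<Rightarrow> 'v \<Rightarrow> real" where
  "edge_return e v = enn2real (mean_return adj v (fst (de e)) (snd (de e)))"

text \<open>Bounded partial sums exclude the value infinity, which \<open>enn2real\<close> would
  silently send to 0.\<close>

lemma mean_return_eq_edge_return: "mean_return adj v (fst (de e)) (snd (de e)) = ennreal (edge_return e v)"
proof -
  obtain K where K: "\<And>n e. (\<Sum>k<n. edge_survival v k e) \<le> K"
    using edge_survival_sum_bounded by blast
  have "mean_return adj v (fst (de e)) (snd (de e)) = (SUP n. \<Sum>k<n. ennreal (edge_survival v k e))"
    by (simp add: mean_return_def survival_eq_edge_survival suminf_eq_SUP)
  also have "\<dots> \<le> ennreal K"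
    using K edge_survival_bounds by (intro SUP_least) (simp add: sum_ennreal ennreal_leI)
  finally show ?thesis
    unfolding edge_return_def by (auto simp: ennreal_enn2real_if top_unique)
qed

lemma edge_return_nonneg: "0 \<le> edge_return e v"
  by (simp add: edge_return_def)

lemma M_ev_entry: "M_ev adj de $ e $ v = (if fst (de e) = v then 0 else edge_return e v)"
proof -
  have "M_ev adj de $ e $ v = mean_time (nbrw_law2 adj (fst (de e)) (snd (de e))) (hit_time v)"
    by (simp add: M_ev_def split_beta)
  also have "\<dots> = enn2real (if fst (de e) = v then 0 else ennreal (edge_return e v))"
    unfolding mean_time_def by (subst nn_integral_hit_time_nbrw_law2, rule de_adj) (simp add: mean_return_eq_edge_return)
  finally show ?thesis
    by (simp add: edge_return_nonneg)
qed

lemma edge_return_eq: "edge_return e v = 1 + (\<Sum>f\<in>UNIV. P $ e $ f * M_ev adj de $ f $ v)"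
proof -
  have "avoid_step adj v (mean_return adj v) (fst (de e)) (snd (de e)) =
      ennreal (if snd (de e) = v then 0 else \<Sum>f\<in>UNIV. P $ e $ f * edge_return f v)"
    using nn_integral_nb_step[of "mean_return adj v" "\<lambda>f. edge_return f v" e] mean_return_eq_edge_return edge_return_nonneg
    by (simp add: avoid_step_def)
  \<comment> \<open>Successors of \<open>e\<close> start at its head, so killing at \<open>v\<close>
    is already encoded in the zero entries of \<open>M_ev\<close> for edges with tail
    \<open>v\<close>.\<close>
  also have "(if snd (de e) = v then 0 else \<Sum>f\<in>UNIV. P $ e $ f * edge_return f v) =
      (\<Sum>f\<in>UNIV. P $ e $ f * M_ev adj de $ f $ v)"
    by (auto simp: M_ev_entry P_entry intro!: sum.cong sum.neutral)
  finally have "ennreal (edge_return e v) = 1 + ennreal (\<Sum>f\<in>UNIV. P $ e $ f * M_ev adj de $ f $ v)"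
    using mean_return_eq[of adj v "fst (de e)" "snd (de e)"] mean_return_eq_edge_return by simp
  also have "\<dots> = ennreal (1 + (\<Sum>f\<in>UNIV. P $ e $ f * M_ev adj de $ f $ v))"
    using P_nonneg edge_return_nonneg by (subst ennreal_plus) (auto intro!: sum_nonneg simp: M_ev_entry)
  finally show ?thesis
    using P_nonneg edge_return_nonneg by (subst (asm) ennreal_inj) (auto intro!: sum_nonneg add_nonneg_nonneg simp: M_ev_entry)
qed

lemma nn_integral_mean_return:
  "(\<integral>\<^sup>+c. mean_return adj v i c \<partial>measure_pmf (pmf_of_set (nbrs adj i))) =
    ennreal ((\<Sum>f | fst (de f) = i. edge_return f v) / d i)"
proof -
  have ne: "nbrs adj i \<noteq> {}"
    using ex_nbr_avoiding[of "{}" i] min_deg[of i] by (auto simp: nbrs_def)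
  have "(\<integral>\<^sup>+c. mean_return adj v i c \<partial>measure_pmf (pmf_of_set (nbrs adj i))) =
      (\<Sum>c\<in>nbrs adj i. mean_return adj v i c) / of_nat (card (nbrs adj i))"
    using ne by (subst nn_integral_pmf_of_set) auto
  also have "(\<Sum>c\<in>nbrs adj i. mean_return adj v i c) = (\<Sum>c\<in>nbrs adj i. ennreal (edge_return (ix i c) v))"
    by (intro sum.cong refl) (simp add: mean_return_eq_edge_return[symmetric] de_ix nbrs_def)
  also have "\<dots> = ennreal (\<Sum>c\<in>nbrs adj i. edge_return (ix i c) v)"
    by (simp add: edge_return_nonneg)
  also have "(\<Sum>c\<in>nbrs adj i. edge_return (ix i c) v) = (\<Sum>f | fst (de f) = i. edge_return f v)"
    using sum_out_edges[of "\<lambda>p. edge_return (inv de p) v" i] by (simp add: ix_de)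
  also have "ennreal (\<Sum>f | fst (de f) = i. edge_return f v) / of_nat (card (nbrs adj i)) =
      ennreal ((\<Sum>f | fst (de f) = i. edge_return f v) / d i)"
    using d_ge_2[of i]
    by (simp add: vdeg_def[symmetric] ennreal_of_nat_eq_real_of_nat divide_ennreal sum_nonneg edge_return_nonneg)
  finally show ?thesis .
qed

lemma M_v_entry: "M_v adj $ i $ v = (\<Sum>f | fst (de f) = i. M_ev adj de $ f $ v) / d i"
proof -
  have "M_v adj $ i $ v = (if i = v then 0 else (\<Sum>f | fst (de f) = i. edge_return f v) / d i)"
    using nn_integral_hit_time[where H="\<lambda>_. 1" and v=v and adj=adj and i=i]
    by (simp add: M_v_def mean_time_def nn_integral_mean_return sum_nonneg edge_return_nonneg)
  then show ?thesis
    by (auto simp: M_ev_entry)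
qed

abbreviation "r i \<equiv> mean_time (nbrw_law adj i) (return_time i)"

lemma r_eq: "d i * r i = (\<Sum>f | fst (de f) = i. edge_return f i)"
  using nn_integral_return_time[where H="\<lambda>_. 1" and v=i and adj=adj and i=i] d_ge_2[of i]
  by (simp add: mean_time_def nn_integral_mean_return sum_nonneg edge_return_nonneg)

lemma Y_entry: "Y_mat adj de $ e $ k = (if k = fst (de e) then edge_return e k else 0)"
proof -
  have "(\<Sum>f | fst (de f) = snd (de e). P $ e $ f * M_ev adj de $ f $ k) =
      (\<Sum>f\<in>UNIV. P $ e $ f * M_ev adj de $ f $ k)"
    by (rule sum.mono_neutral_left) (auto simp: P_entry)
  then show ?thesis
    by (auto simp: Y_mat_def edge_return_eq)
qed

lemma M_v_diag: "M_v adj $ j $ j = 0"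
  by (simp add: M_v_entry M_ev_entry)

section \<open>Matrix form of the first-step equations\<close>

abbreviation "M \<equiv> M_ev adj de"
abbreviation "Y \<equiv> Y_mat adj de"
abbreviation "T \<equiv> T_mat de"
abbreviation "J \<equiv> ones_mat :: real^'v^'e"
abbreviation "D_inv \<equiv> matrix_inv (deg_mat adj)"

text \<open>For edges with tail \<open>v\<close> the hitting time is 0 and not the mean return time;
  \<open>Y\<close> is exactly this correction.\<close>

lemma M_first_step: "(mat 1 - P) ** M = J - Y"
proof -
  have "M $ e $ v = 1 + (P ** M) $ e $ v - Y $ e $ v" for e v
    by (simp add: M_ev_entry Y_entry edge_return_eq matrix_matrix_mult_def)
  then show ?thesis
    by (simp add: matrix_sub_rdistrib vec_eq_iff ones_mat_def)
qed

lemma W_mult: "(W ** X) $ e $ k = (\<Sum>f\<in>UNIV. X $ f $ k) / two_m"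
  by (simp add: matrix_matrix_mult_def W_entry sum_divide_distrib)

lemma D_inv_mult: "(D_inv ** X) $ i $ k = X $ i $ k / d i"
proof -
  have "d i \<noteq> 0" for i
    using d_ge_2[of i] by linarith
  then show ?thesis
    unfolding deg_mat_def by (subst matrix_inv_diag_mat) (auto simp: diag_mat_mult)
qed

lemma T_mult: "(T ** X) $ i $ k = (\<Sum>f | fst (de f) = i. X $ f $ k)"
  by (simp add: T_mat_def matrix_matrix_mult_def if_distrib[of "\<lambda>x. x * _"] sum.If_cases
      Collect_conv_if cong: if_cong)

lemma card_out_edges: "real (card {f. fst (de f) = i}) = d i"
  using sum_out_edges[of "\<lambda>_. 1 :: real" i] by (simp add: vdeg_def)

lemma D_inv_T_const:
  assumes "\<And>e. X $ e $ k = c"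
  shows "(D_inv ** (T ** X)) $ i $ k = c"
  using d_ge_2[of i] by (simp add: D_inv_mult T_mult assms card_out_edges)

lemma sum_by_tail: "(\<Sum>e\<in>UNIV. g e) = (\<Sum>i\<in>UNIV. \<Sum>e | fst (de e) = i. g e)"
  using sum.group[of UNIV UNIV "\<lambda>e. fst (de e)" g] by simp

lemma M_v_eq: "M_v adj = D_inv ** (T ** M)"
  by (simp add: vec_eq_iff D_inv_mult T_mult M_v_entry)

text \<open>The uniform mean over directed edges is the \<open>pi_v\<close>-weighted mean of the
  out-edge averages, and averaging over out-edges leaves constant columns unchanged.\<close>

lemma D_inv_T_W_M: "D_inv ** (T ** (W ** M)) = W_v adj ** M_v adj"
proof -
  have "(\<Sum>e\<in>UNIV. M $ e $ k) = (\<Sum>i\<in>UNIV. d i * M_v adj $ i $ k)" for k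
  proof -
    have "(\<Sum>e | fst (de e) = i. M $ e $ k) = d i * M_v adj $ i $ k" for i
      using d_ge_2[of i] by (simp add: M_v_entry)
    then show ?thesis
      by (simp add: sum_by_tail)
  qed
  then have "(W_v adj ** M_v adj) $ i $ k = (\<Sum>e\<in>UNIV. M $ e $ k) / two_m" for i k
    by (simp add: W_v_def pi_v_def matrix_matrix_mult_def sum_divide_distrib)
  then show ?thesis
    by (simp add: vec_eq_iff D_inv_T_const W_mult)
qed

lemma Z_mult_J: "Z ** J = J"
proof -
  have J: "J = W ** J"
    using two_m_pos by (simp add: vec_eq_iff W_mult) (simp add: ones_mat_def CARD_e)
  have "Z ** J = (Z ** W) ** J"
    by (subst J) (simp add: matrix_mul_assoc)
  then show ?thesis
    by (simp add: Z_mult_W J[symmetric])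
qed

lemma M_eq: "M = J - Z ** Y + W ** M"
proof -
  have "Z ** ((mat 1 - P) ** M) = M - W ** M"
    by (simp only: matrix_mul_assoc Z_mult_Laplacian) (simp add: matrix_sub_rdistrib)
  then show ?thesis
    by (simp add: M_first_step matrix_sub_ldistrib Z_mult_J algebra_simps)
qed

text \<open>The deviation of \<open>edge_return\<close> from its average over the out-edges of the
  tail, that average being \<open>r\<close> by \<open>r_eq\<close>.\<close>

definition "Y_dev = Y - transpose T ** R_mat adj"

lemma Y_dev_entry: "Y_dev $ e $ k = (if k = fst (de e) then edge_return e k - r k else 0)"
  by (auto simp: Y_dev_def R_mat_def mult_diag_mat Y_entry) (simp_all add: transpose_def T_mat_def)

lemma sum_out_Y_dev: "(\<Sum>e | fst (de e) = i. Y_dev $ e $ k) = 0"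
proof (cases "k = i")
  case True
  then show ?thesis
    by (simp add: Y_dev_entry sum_subtractf r_eq[symmetric] card_out_edges)
qed (simp add: Y_dev_entry)

lemma T_mult_Y_dev: "T ** Y_dev = 0"
  by (simp add: vec_eq_iff T_mult sum_out_Y_dev)

lemma W_mult_Y_dev: "W ** Y_dev = 0"
  by (simp add: vec_eq_iff W_mult sum_by_tail sum_out_Y_dev)

text \<open>A row of \<open>P\<close> averages over all out-edges of the head except the reversed
  edge. Used with out-edge sums \<open>d i * r i\<close> for \<open>Y\<close> and 0 for
  \<open>Y_dev\<close>.\<close>

lemma P_mult:
  assumes "\<And>i. (\<Sum>e | fst (de e) = i. X $ e $ k) = s i"
  shows "(P ** X) $ e $ k = (s (snd (de e)) - X $ rev_ix e $ k) / (d (snd (de e)) - 1)"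
proof -
  let ?b = "snd (de e)"
  have "(P ** X) $ e $ k = (\<Sum>f\<in>{f. fst (de f) = ?b} - {rev_ix e}. X $ f $ k / (d ?b - 1))"
    unfolding matrix_matrix_mult_def
    by (simp, rule sum.mono_neutral_cong_right)
       (auto simp: P_entry de_rev inj_de[symmetric] prod_eq_iff)
  also have "\<dots> = (\<Sum>f\<in>{f. fst (de f) = ?b} - {rev_ix e}. X $ f $ k) / (d ?b - 1)"
    by (simp add: sum_divide_distrib)
  also have "(\<Sum>f\<in>{f. fst (de f) = ?b} - {rev_ix e}. X $ f $ k) = s ?b - X $ rev_ix e $ k"
    by (subst sum_diff1) (auto simp: assms de_rev)
  finally show ?thesis .
qed

lemma tau_mult: "(tau_mat de ** X) $ e $ k = X $ rev_ix e $ k"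
proof -
  have "de f = (snd (de e), fst (de e)) \<longleftrightarrow> f = rev_ix e" for f
    by (metis de_rev inj_de)
  then show ?thesis
    by (simp add: tau_mat_def matrix_matrix_mult_def if_distrib[of "\<lambda>x. x * _"] cong: if_cong)
qed

lemma De_inv_mult_F: "matrix_inv (De_mat adj de) ** F_mat adj de = P ** Y_dev"
proof -
  have "(matrix_inv (De_mat adj de) ** F_mat adj de) $ e $ k = (P ** Y_dev) $ e $ k" for e k
  proof -
    let ?b = "snd (de e)"
    have pos: "d i \<noteq> 0" "d i - 1 \<noteq> 0" for i
      using d_ge_2[of i] by linarith+
    have sum_Y: "(\<Sum>e | fst (de e) = i. Y $ e $ k) = (if k = i then d i * r i else 0)" for i
      by (simp add: Y_entry r_eq)
    have "(matrix_inv (De_mat adj de) ** F_mat adj de) $ e $ k = F_mat adj de $ e $ k / d ?b"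
      unfolding De_mat_def 
      by (simp add: matrix_inv_diag_mat[of "\<lambda>e. d (snd (de e))", OF pos(1)] diag_mat_mult)
    also have "F_mat adj de $ e $ k =
        ((if k = ?b then d ?b * r ?b else 0) - Y $ rev_ix e $ k) / (d ?b - 1) - Y $ rev_ix e $ k"
      by (simp add: F_mat_def matrix_sub_rdistrib tau_mult P_mult[of Y, OF sum_Y])
    \<comment> \<open>For \<open>k = ?b\<close> and return value \<open>y\<close> of the reversed
      edge, \<open>(d * r - y) / (d - 1) - y\<close> equals \<open>d * (r - y) / (d - 1)\<close>,
      which cancels the factor \<open>d\<close>.\<close>
    also have "\<dots> / d ?b = - Y_dev $ rev_ix e $ k / (d ?b - 1)"
      using pos[of ?b] by (auto simp: Y_dev_entry Y_entry de_rev field_simps)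
    also have "\<dots> = (P ** Y_dev) $ e $ k"
      by (simp add: P_mult[of Y_dev, OF sum_out_Y_dev])
    finally show ?thesis .
  qed
  then show ?thesis
    by (simp add: vec_eq_iff)
qed

lemma D_inv_T_Z_Y: "D_inv ** (T ** (Z ** Y)) = Z_v adj de ** R_mat adj + E_mat adj de"
proof -
  have "Z ** Y_dev - Z ** (P ** Y_dev) = (Z ** (mat 1 - P)) ** Y_dev"
    by (simp add: matrix_sub_ldistrib matrix_sub_rdistrib matrix_mul_assoc)
  also have "\<dots> = Y_dev"
    by (simp add: Z_mult_Laplacian matrix_sub_rdistrib W_mult_Y_dev)
  finally have "T ** (Z ** Y_dev) = T ** (Z ** (P ** Y_dev))"
    using T_mult_Y_dev by (metis eq_iff_diff_eq_0 matrix_sub_ldistrib)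
  moreover have "Y = transpose T ** R_mat adj + Y_dev"
    by (simp add: Y_dev_def)
  moreover have "E_mat adj de = D_inv ** (T ** (Z ** (P ** Y_dev)))"
    unfolding E_mat_def De_inv_mult_F[symmetric] by (simp add: matrix_mul_assoc)
  ultimately show ?thesis
    unfolding Z_v_def by (simp add: matrix_add_ldistrib matrix_mul_assoc)
qed

theorem M_v_matrix_eq:
  "M_v adj = ones_mat - Z_v adj de ** R_mat adj + W_v adj ** M_v adj - E_mat adj de"
proof -
  have J: "D_inv ** (T ** J) = ones_mat"
    by (simp add: vec_eq_iff D_inv_T_const ones_mat_def)
  have "M_v adj = D_inv ** (T ** (J - Z ** Y + W ** M))"
    using M_eq M_v_eq by simp
  also have "\<dots> = D_inv ** (T ** J) - D_inv ** (T ** (Z ** Y)) + D_inv ** (T ** (W ** M))"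
    by (simp only: matrix_add_ldistrib matrix_sub_ldistrib)
  also have "\<dots> = ones_mat - (Z_v adj de ** R_mat adj + E_mat adj de) + W_v adj ** M_v adj"
    by (simp only: J D_inv_T_Z_Y D_inv_T_W_M)
  finally show ?thesis
    by (simp add: algebra_simps)
qed

text \<open>Kac's formula for the non-backtracking walk: unit column sums of \<open>P\<close>
  eliminate \<open>M\<close> from the summed first-step equations, so the entries in column
  \<open>k\<close> of \<open>Y\<close> add up to \<open>two_m\<close>.\<close>

lemma r_eq_inverse_pi: "r k = 1 / pi_v adj $ k"
proof -
  have "(\<Sum>e\<in>UNIV. (P ** M) $ e $ k) = (\<Sum>f\<in>UNIV. M $ f $ k)"
    unfolding matrix_matrix_mult_def
    by (simp, subst sum.swap) (simp add: sum_distrib_right[symmetric] P_col)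
  moreover have "(\<Sum>e\<in>UNIV. M $ e $ k - (P ** M) $ e $ k) = (\<Sum>e\<in>UNIV. 1 - Y $ e $ k)"
    using M_first_step by (simp add: matrix_sub_rdistrib vec_eq_iff ones_mat_def)
  ultimately have "(\<Sum>e\<in>UNIV. Y $ e $ k) = two_m"
    by (simp add: sum_subtractf CARD_e)
  moreover have "(\<Sum>e\<in>UNIV. Y $ e $ k) = d k * r k"
  proof -
    have "(\<Sum>e\<in>UNIV. Y $ e $ k) = (\<Sum>e | fst (de e) = k. edge_return e k)"
      by (rule sum.mono_neutral_cong_right) (auto simp: Y_entry)
    then show ?thesis
      by (simp add: r_eq)
  qed
  ultimately show ?thesis
    using d_ge_2[of k] by (simp add: pi_v_def field_simps)
qed

theorem M_v_entry_eq:
  "M_v adj $ i $ j = (Z_v adj de $ j $ j - Z_v adj de $ i $ j) / pi_v adj $ j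
     + E_mat adj de $ j $ j - E_mat adj de $ i $ j"
proof -
  \<comment> \<open>The term from \<open>W_v\<close> does not depend on the row, so subtracting the
    row \<open>j\<close> equation, where the hitting time is 0, removes it.\<close>
  define s where "s = (\<Sum>l\<in>UNIV. pi_v adj $ l * M_v adj $ l $ j)"
  have *: "M_v adj $ i $ j = 1 - Z_v adj de $ i $ j * r j + s - E_mat adj de $ i $ j" for i
  proof -
    have "(W_v adj ** M_v adj) $ i $ j = s"
      by (simp add: W_v_def matrix_matrix_mult_def s_def)
    then show ?thesis
      by (subst M_v_matrix_eq) (simp add: ones_mat_def R_mat_def mult_diag_mat)
  qed
  show ?thesis
    using *[of i] *[of j] M_v_diag[of j] by (simp add: r_eq_inverse_pi diff_divide_distrib)
qed

end

theorem mainTheorem10: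
  fixes adj :: "'v::finite \<Rightarrow> 'v \<Rightarrow> bool" and de :: "'e::finite \<Rightarrow> 'v \<times> 'v"
  assumes "simple_graph adj" and "connected_graph adj"
    and "\<forall>v. 2 \<le> vdeg adj v" and "\<not> cycle_graph adj"
    and "indexes_dir_edges adj de"
  shows "M_v adj = ones_mat - Z_v adj de ** R_mat adj + W_v adj ** M_v adj - E_mat adj de \<and>
    (\<forall>i j. M_v adj $ i $ j =
       (Z_v adj de $ j $ j - Z_v adj de $ i $ j) / pi_v adj $ j
         + E_mat adj de $ j $ j - E_mat adj de $ i $ j)"
proof -
  interpret nb_graph adj de
    using assms by unfold_locales auto
  show ?thesis
    using M_v_matrix_eq M_v_entry_eq by blast
qed

end
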